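(* The quantity $R_n(t)$ satisfies the following second order differential equation: $$R_n''(t)=\frac{(R_n'(t))^2}{2R_n(t)}+\frac38R_n^3(t)-\frac t2R_n^2(t)+\frac18\left(t^2-8n-4-4\gamma\right)R_n(t)-\frac{\gamma^2}{2R_n(t)},$$ which is a particular Painlevé IV equation. Moreover, let $\widetilde R_n:=\frac12R_n(t)$ and $u:=-\frac14t$; then $$\widetilde R_n''(u)=\frac{(\widetilde R_n'(u))^2}{2\widetilde R_n(u)}+\frac32\widetilde R_n^3(u)+4u\widetilde R_n^2(u)+2\left(u^2-\theta_1\right)\widetilde R_n(u)+\frac{\theta_2}{\widetilde R_n(u)},$$ which is the Painlevé IV equation with $\theta_1=\frac{2n+1+\gamma}{4}$, $\theta_2=-\frac{\gamma^2}{8}$.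
   Context: Let $A\ge 0$, $A+B\ge 0$, $\gamma>-1$. For $t\in\mathbb{R}$ let $w(z)=w(z,t,\gamma)=e^{-z^2+tz}|z-t|^{\gamma}(A+B\theta(z-t))$ for $z\in\mathbb{R}$, where $\theta(x)=1$ for $x>0$ and $\theta(x)=0$ for $x\le 0$. Let $P_n(z)=P_n(z,t,\gamma)$ be the monic polynomials of degree $n$ orthogonal with respect to $w$: $\int_{\mathbb{R}}P_jP_i\,w\,dz=h_j\delta_{ij}$, with $h_n=h_n(t)$. Define $$R_n(t)=\frac{\gamma}{h_n}\int_{\mathbb{R}}\frac{P_n^2(y)w(y)}{y-t}\,dy .$$
   Formalization: Second equation is false with primes as d/du (factor 16); proved with primes as d/dt, u=-t/4. Painlevé IV is proved for y(s)=R_n(-2s) with parameters 2n+1+γ, -2γ². R_n(t)≠0 is assumed; for γ≤0 the divergent integral is read as its finite part. *)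

theory Defs
  imports "HOL-Analysis.Analysis" "HOL-Computational_Algebra.Polynomial"
begin

definition heaviside :: "real \<Rightarrow> real" where
  "heaviside x = (if x > 0 then 1 else 0)"

(* At z = t the factor |z - t| powr \<gamma> has the junk value 0; this is a null set. *)
definition weight :: "real \<Rightarrow> real \<Rightarrow> real \<Rightarrow> real \<Rightarrow> real \<Rightarrow> real" where
  "weight \<gamma> A B t z =
     exp (- (z\<^sup>2) + t * z) * \<bar>z - t\<bar> powr \<gamma> * (A + B * heaviside (z - t))"

definition monic_orthogonal :: "(real \<Rightarrow> real) \<Rightarrow> (nat \<Rightarrow> real poly) \<Rightarrow> (nat \<Rightarrow> real) \<Rightarrow> bool" where
  "monic_orthogonal w P h \<longleftrightarrow>
     (\<forall>i. degree (P i) = i \<and> lead_coeff (P i) = 1) \<and>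
     (\<forall>i j. (LINT z|lborel. poly (P j) z * poly (P i) z * w z) = (if i = j then h j else 0))"

(* \<gamma> times the integral of p^2 w / (y - t) over the real line.
   For \<gamma> > 0 this is an absolutely convergent Lebesgue integral.
   For -1 < \<gamma> \<le> 0 that integral diverges in general and is read as its finite part.
   Near y = t the numerator p(y)^2 exp(-y^2 + t y) tends to p(t)^2, so with
   |y - t| > \<epsilon> cut out the two sides contribute, up to a convergent term,
     (A + B) p(t)^2 (- \<epsilon>^\<gamma> / \<gamma>)  and  A p(t)^2 (\<epsilon>^\<gamma> / \<gamma>),
   i.e. - B p(t)^2 \<epsilon>^\<gamma> after multiplication by \<gamma>. Adding B p(t)^2 \<epsilon>^\<gamma> removes this.
   For \<gamma> > 0 the added term vanishes as \<epsilon> tends to 0, so the second branch is the analytic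
   continuation in \<gamma> of the first one; for B = 0 and \<gamma> < 0 it is the principal value,
   and for \<gamma> = 0 it is B p(t)^2. *)
definition scaled_cauchy_integral :: "real \<Rightarrow> real \<Rightarrow> real \<Rightarrow> real \<Rightarrow> real poly \<Rightarrow> real" where
  "scaled_cauchy_integral \<gamma> A B t p =
     (if \<gamma> > 0
      then \<gamma> * (LINT y|lborel. (poly p y)\<^sup>2 * weight \<gamma> A B t y / (y - t))
      else Lim (at_right 0) (\<lambda>\<epsilon>.
             \<gamma> * (LINT y:{y. \<bar>y - t\<bar> > \<epsilon>}|lborel. (poly p y)\<^sup>2 * weight \<gamma> A B t y / (y - t))
             + B * (poly p t)\<^sup>2 * \<epsilon> powr \<gamma>))"

(* deriv is total, so the existence of both derivatives is required explicitly. *)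
definition twice_differentiable_at :: "(real \<Rightarrow> real) \<Rightarrow> real \<Rightarrow> bool" where
  "twice_differentiable_at f t \<longleftrightarrow>
     (\<forall>\<^sub>F s in nhds t. f differentiable (at s)) \<and> deriv f differentiable (at t)"

definition painleve_IV :: "real \<Rightarrow> real \<Rightarrow> (real \<Rightarrow> real) \<Rightarrow> real \<Rightarrow> bool" where
  "painleve_IV \<theta>1 \<theta>2 y s \<longleftrightarrow>
     twice_differentiable_at y s \<and> y s \<noteq> 0 \<and>
     deriv (deriv y) s =
       (deriv y s)\<^sup>2 / (2 * y s) + 3 / 2 * (y s) ^ 3 + 4 * s * (y s)\<^sup>2
       + 2 * (s\<^sup>2 - \<theta>1) * y s + \<theta>2 / y s"

end

theory Submission
  imports Defs "HOL-Real_Asymp.Real_Asymp"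
begin

text \<open>
  Substituting z = x + s turns the weight into exp (- x^2 - s x) |x|^\<gamma> (A + B \<theta>(x)), which depends on s
  only through the factor exp (- s x). The corresponding moment functional L therefore satisfies
  d/ds L p = - L (x p), and an integration by parts gives the Pearson relation
  L (x q') = L ((2 x^2 + s x - 1 - \<gamma>) q). The same integration by parts identifies the Cauchy integral,
  or its finite part, and yields R = 2 \<alpha> + s, where \<alpha> and \<beta> are the recurrence coefficients of the
  orthogonal polynomials.

  The first property of L gives the Toda equations
  \<alpha>(n)' = \<beta>(n) - \<beta>(n+1) and \<beta>(n)' = \<beta>(n) (\<alpha>(n-1) - \<alpha>(n)).
  The second one gives the discrete system
  2 \<beta>(n+1) + 2 \<beta>(n) + \<alpha>(n) R(n) = 2 n + 1 + \<gamma> and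
  \<beta>(n) R(n) R(n-1) = (2 \<beta>(n) - n) (2 \<beta>(n) - n - \<gamma>).
  Eliminating \<beta>(n), \<beta>(n+1) and R(n-1) leaves the Painleve IV equation for R(n).
\<close>

section \<open>Orthogonal polynomials of a Pearson functional\<close>

definition coeffwise_derivative :: "(real \<Rightarrow> real poly) \<Rightarrow> real poly \<Rightarrow> real \<Rightarrow> bool" where
  "coeffwise_derivative F F' t \<longleftrightarrow>
     (\<forall>k. ((\<lambda>s. coeff (F s) k) has_real_derivative coeff F' k) (at t))"

lemma coeffwise_derivative_const: "coeffwise_derivative (\<lambda>s. p) 0 t"
  by (simp add: coeffwise_derivative_def)

lemma coeffwise_derivative_diff:
  assumes "coeffwise_derivative F F' t" "coeffwise_derivative G G' t"
  shows "coeffwise_derivative (\<lambda>s. F s - G s) (F' - G') t"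
  using assms by (auto simp: coeffwise_derivative_def intro!: derivative_eq_intros)

lemma coeffwise_derivative_mult:
  assumes "coeffwise_derivative F F' t" "coeffwise_derivative G G' t"
  shows "coeffwise_derivative (\<lambda>s. F s * G s) (F' * G t + F t * G') t"
proof -
  have "((\<lambda>s. \<Sum>i\<le>k. coeff (F s) i * coeff (G s) (k - i)) has_real_derivative
      (\<Sum>i\<le>k. coeff F' i * coeff (G t) (k - i) + coeff (F t) i * coeff G' (k - i))) (at t)" for k
    using assms unfolding coeffwise_derivative_def
    by (intro DERIV_sum) (auto intro!: derivative_eq_intros)
  then show ?thesis
    by (simp add: coeffwise_derivative_def coeff_mult sum.distrib)
qed

lemma coeffwise_derivative_smult:
  assumes "(c has_real_derivative c') (at t)" "coeffwise_derivative F F' t"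
  shows "coeffwise_derivative (\<lambda>s. smult (c s) (F s)) (smult c' (F t) + smult (c t) F') t"
  using assms by (auto simp: coeffwise_derivative_def intro!: derivative_eq_intros)

lemma coeffwise_derivative_coeff:
  "coeffwise_derivative F F' t \<Longrightarrow> ((\<lambda>s. coeff (F s) k) has_real_derivative coeff F' k) (at t)"
  by (simp add: coeffwise_derivative_def)

section \<open>Orthogonality with respect to an abstract functional\<close>

text \<open>All analysis is packed into \<open>L_deriv\<close> and \<open>pearson\<close>, so
  everything inside the locale is algebra of coefficients plus the product rule. The assumption
  \<open>h_nonzero\<close> makes the quotients defining \<open>\<alpha>\<close> and
  \<open>\<beta>\<close> genuine.\<close>

locale pearson_functional =
  fixes L :: "real \<Rightarrow> real poly \<Rightarrow> real" and \<gamma> :: real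
    and Q :: "real \<Rightarrow> nat \<Rightarrow> real poly" and h :: "real \<Rightarrow> nat \<Rightarrow> real"
  assumes L_add: "L s (p + q) = L s p + L s q"
    and L_smult: "L s (smult c p) = c * L s p"
    and L_deriv: "((\<lambda>s. L s p) has_real_derivative - L t ([:0, 1:] * p)) (at t)"
    and pearson: "L s ([:0, 1:] * pderiv q) = L s ([:- (1 + \<gamma>), s, 2:] * q)"
    and degree_Q: "degree (Q s n) = n"
    and monic_Q: "coeff (Q s n) n = 1"
    and L_Q: "L s (Q s i * Q s j) = (if i = j then h s j else 0)"
    and h_nonzero: "h s n \<noteq> 0"
begin

lemma L_0 [simp]: "L s 0 = 0"
  using L_smult[of s 0 0] by simp

lemma L_uminus: "L s (- p) = - L s p"
  using L_smult[of s "-1" p] by simp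

lemma L_diff: "L s (p - q) = L s p - L s q"
  using L_add[of s p "-q"] L_uminus by simp

lemma L_sum: "L s (sum f S) = (\<Sum>i\<in>S. L s (f i))"
  by (induction S rule: infinite_finite_induct) (auto simp: L_add)

lemma coeff_Q_above: "n < k \<Longrightarrow> coeff (Q s n) k = 0"
  by (simp add: coeff_eq_0 degree_Q)

text \<open>The polynomials of index below n span everything of degree below n: subtracting
  \<open>coeff p m\<close> times \<open>Q s m\<close> removes the top term, which drives the
  induction on m. Vanishing coefficients instead of a degree bound let n = 0 mean p = 0.\<close>

lemma L_Q_lower:
  assumes "\<And>k. k \<ge> n \<Longrightarrow> coeff p k = 0"
  shows "L s (Q s n * p) = 0"
proof -
  have "L s (Q s n * p) = 0" if "m \<le> n" "\<And>k. k \<ge> m \<Longrightarrow> coeff p k = 0" for m p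
    using that
  proof (induction m arbitrary: p)
    case 0
    then have "p = 0" by (simp add: poly_eq_iff)
    then show ?case by simp
  next
    case (Suc m)
    define r where "r = p - smult (coeff p m) (Q s m)"
    have "coeff r k = 0" if "k \<ge> m" for k
      using that Suc.prems(2)[of k] coeff_Q_above[of m k s] monic_Q[of s m]
      by (cases "k = m") (auto simp: r_def)
    then have "L s (Q s n * r) = 0"
      using Suc by simp
    moreover have "p = r + smult (coeff p m) (Q s m)"
      by (simp add: r_def)
    then have "L s (Q s n * p) = L s (Q s n * r) + coeff p m * L s (Q s n * Q s m)"
      by (metis L_add L_smult distrib_left mult_smult_right)
    ultimately show ?case
      using Suc.prems(1) by (simp add: L_Q)
  qed
  then show ?thesis using assms by blast
qed

text \<open>Modulo terms killed by \<open>L_Q_lower\<close>, p is \<open>coeff p n\<close> times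
  \<open>Q s n\<close>. Pairing with \<open>Q s n\<close> thus reads off a leading coefficient, the
  device behind most identities below.\<close>

lemma L_Q_top:
  assumes "\<And>k. k > n \<Longrightarrow> coeff p k = 0"
  shows "L s (Q s n * p) = coeff p n * h s n"
proof -
  define r where "r = p - smult (coeff p n) (Q s n)"
  have "coeff r k = 0" if "k \<ge> n" for k
    using that assms[of k] coeff_Q_above[of n k s] monic_Q[of s n]
    by (cases "k = n") (auto simp: r_def)
  then have "L s (Q s n * r) = 0"
    by (rule L_Q_lower)
  moreover have "p = r + smult (coeff p n) (Q s n)"
    by (simp add: r_def)
  then have "L s (Q s n * p) = L s (Q s n * r) + coeff p n * L s (Q s n * Q s n)"
    by (metis L_add L_smult distrib_left mult_smult_right)
  ultimately show ?thesis
    by (simp add: L_Q)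
qed

lemma eq_0_if_orthogonal:
  assumes "\<And>k. L s (Q s k * p) = 0"
  shows "p = 0"
  using L_Q_top[of "degree p" p s] assms[of "degree p"] h_nonzero
  by (auto simp: coeff_eq_0)

section \<open>Recurrence coefficients and the three-term recurrence\<close>

definition \<alpha> :: "real \<Rightarrow> nat \<Rightarrow> real" where
  "\<alpha> s n = L s ([:0, 1:] * Q s n * Q s n) / h s n"

text \<open>With the value 0 at n = 0, formulas mentioning the index n - 1 stay correct at n = 0,
  where truncated subtraction turns n - 1 into 0.\<close>

definition \<beta> :: "real \<Rightarrow> nat \<Rightarrow> real" where
  "\<beta> s n = (if n = 0 then 0 else h s n / h s (n - 1))"

lemma \<beta>_0 [simp]: "\<beta> s 0 = 0"
  by (simp add: \<beta>_def)

lemma \<beta>_Suc_mult: "\<beta> s (Suc n) * h s n = h s (Suc n)"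
  by (simp add: \<beta>_def h_nonzero)

lemma L_X_Q_Q: "L s ([:0, 1:] * Q s n * Q s n) = \<alpha> s n * h s n"
  by (simp add: \<alpha>_def h_nonzero)

text \<open>x times \<open>Q s n\<close> is monic of degree n + 1.\<close>

lemma L_X_Q_Suc: "L s ([:0, 1:] * Q s n * Q s (Suc n)) = h s (Suc n)"
proof -
  have "L s (Q s (Suc n) * ([:0, 1:] * Q s n)) = coeff ([:0, 1:] * Q s n) (Suc n) * h s (Suc n)"
    by (rule L_Q_top) (auto simp: coeff_pCons coeff_Q_above split: nat.split)
  then show ?thesis
    by (simp add: mult_ac monic_Q)
qed

lemma L_X_Q_far:
  assumes "Suc n < k"
  shows "L s ([:0, 1:] * Q s n * Q s k) = 0"
proof -
  have "L s (Q s k * ([:0, 1:] * Q s n)) = 0"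
    using assms
    by (intro L_Q_lower) (auto simp: coeff_pCons coeff_Q_above split: nat.split)
  then show ?thesis by (simp add: mult_ac)
qed

text \<open>The remainder r is orthogonal to every \<open>Q s k\<close>, hence 0. For k < n the
  factor x is moved from \<open>Q s n\<close> to \<open>Q s k\<close>, where the degree count
  applies again.\<close>

lemma three_term:
  "[:0, 1:] * Q s n = Q s (Suc n) + smult (\<alpha> s n) (Q s n) + smult (\<beta> s n) (Q s (n - 1))"
proof -
  define r where
    "r = [:0, 1:] * Q s n - Q s (Suc n) - smult (\<alpha> s n) (Q s n) - smult (\<beta> s n) (Q s (n - 1))"
  have eq: "L s (Q s k * r) = L s ([:0, 1:] * Q s n * Q s k) - L s (Q s k * Q s (Suc n))
      - \<alpha> s n * L s (Q s k * Q s n) - \<beta> s n * L s (Q s k * Q s (n - 1))" for k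
    unfolding r_def right_diff_distrib L_diff by (simp add: L_smult mult_ac)
  have "L s (Q s k * r) = 0" for k
  proof -
    have swap: "L s ([:0, 1:] * Q s n * Q s k) = L s ([:0, 1:] * Q s k * Q s n)"
      by (simp only: mult_ac)
    consider "k = n" | "k = Suc n" | "k > Suc n" | "n = Suc k" | "n > Suc k" by linarith
    then show ?thesis
    proof cases
      case 1
      \<comment> \<open>At n = 0 the truncated index n - 1 equals k, and only \<beta> = 0 removes
        the last term.\<close>
      then show ?thesis using L_X_Q_Q[of s n] by (cases n) (auto simp: eq L_Q)
    next
      case 2
      then show ?thesis using L_X_Q_Suc[of s n] by (cases n) (auto simp: eq L_Q)
    next
      case 3
      then show ?thesis using L_X_Q_far[of n k s] by (auto simp: eq L_Q)
    next
      case 4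
      then show ?thesis using swap L_X_Q_Suc[of s k] \<beta>_Suc_mult[of s k]
        by (auto simp: eq L_Q)
    next
      case 5
      then show ?thesis using swap L_X_Q_far[of k n s] by (auto simp: eq L_Q)
    qed
  qed
  then have "r = 0" by (rule eq_0_if_orthogonal)
  then show ?thesis by (simp add: r_def algebra_simps)
qed

text \<open>One factor x \<open>Q s n\<close> is expanded by \<open>three_term\<close>, leaving
  pairings that contain a single x. The same expansion serves the neighbouring product in
  \<open>L_XX_Q_Suc\<close>.\<close>

lemma L_XX_Q_Q:
  "L s ([:0, 1:] * ([:0, 1:] * (Q s n * Q s n))) = (\<beta> s (Suc n) + (\<alpha> s n)\<^sup>2 + \<beta> s n) * h s n"
proof -
  have "L s ([:0, 1:] * ([:0, 1:] * (Q s n * Q s n))) = L s ([:0, 1:] * Q s n * ([:0, 1:] * Q s n))"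
    by (simp only: mult_ac)
  also have "\<dots> = L s ([:0, 1:] * Q s n * (Q s (Suc n) + smult (\<alpha> s n) (Q s n) + smult (\<beta> s n) (Q s (n - 1))))"
    by (simp only: three_term[symmetric])
  also have "\<dots> = L s ([:0, 1:] * Q s n * Q s (Suc n)) + \<alpha> s n * L s ([:0, 1:] * Q s n * Q s n)
      + \<beta> s n * L s ([:0, 1:] * Q s n * Q s (n - 1))"
    by (simp only: distrib_left L_add mult_smult_right L_smult)
  also have "\<beta> s n * L s ([:0, 1:] * Q s n * Q s (n - 1)) = \<beta> s n * h s n"
    using L_X_Q_Suc[of s "n - 1"] by (cases n) (auto simp: mult_ac)
  finally show ?thesis
    unfolding L_X_Q_Suc L_X_Q_Q using \<beta>_Suc_mult[of s n]
    by (simp add: algebra_simps power2_eq_square)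
qed

lemma L_XX_Q_Suc:
  "L s ([:0, 1:] * ([:0, 1:] * (Q s n * Q s (Suc n)))) = (\<alpha> s n + \<alpha> s (Suc n)) * h s (Suc n)"
proof -
  have "L s ([:0, 1:] * ([:0, 1:] * (Q s n * Q s (Suc n)))) = L s ([:0, 1:] * Q s (Suc n) * ([:0, 1:] * Q s n))"
    by (simp only: mult_ac)
  also have "\<dots> = L s ([:0, 1:] * Q s (Suc n) * (Q s (Suc n) + smult (\<alpha> s n) (Q s n) + smult (\<beta> s n) (Q s (n - 1))))"
    by (simp only: three_term[symmetric])
  also have "\<dots> = L s ([:0, 1:] * Q s (Suc n) * Q s (Suc n)) + \<alpha> s n * L s ([:0, 1:] * Q s n * Q s (Suc n))
      + \<beta> s n * L s ([:0, 1:] * Q s (n - 1) * Q s (Suc n))"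
    by (simp only: distrib_left L_add mult_smult_right L_smult mult_ac)
  also have "\<beta> s n * L s ([:0, 1:] * Q s (n - 1) * Q s (Suc n)) = 0"
    using L_X_Q_far[of "n - 1" "Suc n" s] by (cases n) auto
  finally show ?thesis
    unfolding L_X_Q_Suc L_X_Q_Q by (simp add: algebra_simps)
qed

section \<open>The discrete system from the Pearson relation\<close>

lemma L_pearson:
  "L s ([:0, 1:] * pderiv q) =
     2 * L s ([:0, 1:] * ([:0, 1:] * q)) + s * L s ([:0, 1:] * q) - (1 + \<gamma>) * L s q"
proof -
  have "[:- (1 + \<gamma>), s, 2:] * q = smult 2 ([:0, 1:] * ([:0, 1:] * q)) + smult s ([:0, 1:] * q)
      - smult (1 + \<gamma>) q"
    by (rule poly_eq_poly_eq_iff[THEN iffD1]) (auto simp: fun_eq_iff algebra_simps)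
  then show ?thesis
    unfolding pearson by (simp only: L_add L_smult L_diff)
qed

text \<open>The Euler operator x d/dx is diagonal on monomials, so it preserves degrees and its
  leading coefficients are explicit.\<close>

lemma coeff_X_pderiv: "coeff ([:0, 1:] * pderiv p) k = real k * coeff p k"
  by (cases k) (auto simp: coeff_pderiv)

text \<open>The Pearson relation for the square of \<open>Q s n\<close>: x times the derivative of
  \<open>Q s n\<close> has leading coefficient n, so the left-hand side is 2 n
  \<open>h s n\<close>.\<close>

lemma discrete_first:
  "2 * \<beta> s (Suc n) + 2 * \<beta> s n + \<alpha> s n * (2 * \<alpha> s n + s) = 2 * real n + 1 + \<gamma>"
proof -
  have "L s (Q s n * ([:0, 1:] * pderiv (Q s n))) = n * h s n"
    using L_Q_top[of n "[:0, 1:] * pderiv (Q s n)" s]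
    unfolding coeff_X_pderiv by (simp add: coeff_Q_above monic_Q)
  moreover have "[:0, 1:] * pderiv (Q s n * Q s n) = smult 2 (Q s n * ([:0, 1:] * pderiv (Q s n)))"
    by (rule poly_eq_poly_eq_iff[THEN iffD1]) (auto simp: fun_eq_iff pderiv_mult algebra_simps)
  ultimately have "L s ([:0, 1:] * pderiv (Q s n * Q s n)) = 2 * (n * h s n)"
    by (simp only: L_smult)
  then have "2 * (n * h s n) = (2 * (\<beta> s (Suc n) + (\<alpha> s n)\<^sup>2 + \<beta> s n) + s * \<alpha> s n - (1 + \<gamma>)) * h s n"
    unfolding L_pearson L_XX_Q_Q
    using L_X_Q_Q[of s n] L_Q[of s n n] by (simp add: algebra_simps)
  then have "2 * n = 2 * (\<beta> s (Suc n) + (\<alpha> s n)\<^sup>2 + \<beta> s n) + s * \<alpha> s n - (1 + \<gamma>)"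
    using h_nonzero by simp
  then show ?thesis by (simp add: algebra_simps power2_eq_square)
qed

text \<open>Comparison of the coefficients of x^n in \<open>three_term\<close>. The conditional
  factor suppresses \<open>coeff (Q s 0) 0\<close>, which is 1 and would enter through the truncated
  index.\<close>

lemma coeff_Q_subleading: "coeff (Q s (Suc n)) n = coeff (Q s n) (n - 1) * (if n = 0 then 0 else 1) - \<alpha> s n"
proof -
  have "coeff ([:0, 1:] * Q s n) n =
      coeff (Q s (Suc n)) n + \<alpha> s n * coeff (Q s n) n + \<beta> s n * coeff (Q s (n - 1)) n"
    unfolding three_term by simp
  then show ?thesis
    by (cases n) (auto simp: monic_Q coeff_Q_above)
qed

text \<open>The Pearson relation for \<open>Q s n * Q s (Suc n)\<close>. Of the two terms of the
  product rule, the one that differentiates \<open>Q s n\<close> vanishes by orthogonality.\<close>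

lemma coeff_Q_subleading_eq:
  "coeff (Q s (Suc n)) n = - \<beta> s (Suc n) * (2 * \<alpha> s n + 2 * \<alpha> s (Suc n) + s)"
proof -
  define c where "c = coeff (Q s (Suc n)) n"
  \<comment> \<open>The operator n + 1 - x d/dx kills the leading term of \<open>Q s (Suc n)\<close>
    and multiplies its x^n coefficient by 1, so pairing D with \<open>Q s n\<close> yields
    c.\<close>
  define D where "D = smult (real (Suc n)) (Q s (Suc n)) - [:0, 1:] * pderiv (Q s (Suc n))"
  have coeff_D: "coeff D k = (real (Suc n) - real k) * coeff (Q s (Suc n)) k" for k
    unfolding D_def coeff_diff coeff_X_pderiv by (simp add: algebra_simps)
  have "L s (Q s n * D) = c * h s n"
    using L_Q_top[of n D s] coeff_Q_above[of "Suc n" _ s] unfolding coeff_D c_def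
    by (metis (no_types, lifting) Suc_lessI cancel_comm_monoid_add_class.diff_cancel mult_1 mult_eq_0_iff
        of_nat_1 of_nat_Suc add_diff_cancel_left' add.commute)
  moreover have "L s (Q s n * D) = - L s (Q s n * ([:0, 1:] * pderiv (Q s (Suc n))))"
    unfolding D_def right_diff_distrib L_diff by (simp add: L_smult L_Q)
  moreover have "L s (Q s (Suc n) * ([:0, 1:] * pderiv (Q s n))) = 0"
    by (rule L_Q_lower) (simp only: coeff_X_pderiv, simp add: coeff_Q_above)
  moreover have "[:0, 1:] * pderiv (Q s n * Q s (Suc n)) =
      Q s n * ([:0, 1:] * pderiv (Q s (Suc n))) + Q s (Suc n) * ([:0, 1:] * pderiv (Q s n))"
    unfolding pderiv_mult distrib_left by (simp only: mult_ac)
  ultimately have "L s ([:0, 1:] * pderiv (Q s n * Q s (Suc n))) = - c * h s n"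
    by (simp only: L_add)
  then have "- c * h s n = (2 * (\<alpha> s n + \<alpha> s (Suc n)) + s) * h s (Suc n)"
    unfolding L_pearson L_XX_Q_Suc using L_X_Q_Suc[of s n] L_Q[of s n "Suc n"]
    by (simp add: algebra_simps)
  also have "\<dots> = \<beta> s (Suc n) * (2 * \<alpha> s n + 2 * \<alpha> s (Suc n) + s) * h s n"
    unfolding \<beta>_Suc_mult[of s n, symmetric] by (simp add: algebra_simps)
  finally have "- c = \<beta> s (Suc n) * (2 * \<alpha> s n + 2 * \<alpha> s (Suc n) + s)"
    by (simp only: mult_right_cancel[OF h_nonzero])
  then show ?thesis
    by (simp add: c_def)
qed

text \<open>The difference of the two sides is constant in n: the increment of the left-hand side is
  obtained by multiplying the difference of two consecutive relations for the subleading coefficient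
  by 2 \<alpha> s n + s, and it factors like the increment of the right-hand side.\<close>

lemma discrete_second:
  "\<beta> s n * (2 * \<alpha> s n + s) * (2 * \<alpha> s (n - 1) + s) = (2 * \<beta> s n - n) * (2 * \<beta> s n - n - \<gamma>)"
proof (induction n)
  case 0
  show ?case by simp
next
  case (Suc n)
  define a b c b' where "a = \<alpha> s n" and "b = \<alpha> s (Suc n)" and "c = \<beta> s (Suc n)" and "b' = \<beta> s n"
  have step: "a = c * (2 * a + 2 * b + s) - b' * (2 * a + 2 * \<alpha> s (n - 1) + s)"
    using coeff_Q_subleading[of s n] coeff_Q_subleading_eq[of s n] coeff_Q_subleading_eq[of s "n - 1"]
    by (cases n) (auto simp: a_def b_def c_def b'_def algebra_simps)
  have fst: "a * (2 * a + s) = 2 * real n + 1 + \<gamma> - 2 * c - 2 * b'"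
    using discrete_first[of s n] by (simp add: a_def b_def c_def b'_def)
  have IH: "b' * (2 * a + s) * (2 * \<alpha> s (n - 1) + s) = (2 * b' - n) * (2 * b' - n - \<gamma>)"
    using Suc by (simp add: a_def b'_def)
  have "c * (2 * b + s) * (2 * a + s) =
      b' * (2 * a + s) * (2 * \<alpha> s (n - 1) + s) + a * (2 * a + s) * (1 - 2 * c + 2 * b')"
    using arg_cong[OF step, of "\<lambda>x. x * (2 * a + s)"] by (simp add: algebra_simps)
  \<comment> \<open>With u = 2 c - (n + 1) and v = 2 b' - n, the added term becomes (u - v) (u + v -
    \<gamma>) = u (u - \<gamma>) - v (v - \<gamma>), and IH cancels the part in v.\<close>
  also have "\<dots> = (2 * c - Suc n) * (2 * c - Suc n - \<gamma>)"
    unfolding fst IH by (simp add: algebra_simps)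
  finally show ?case by (simp add: a_def b_def c_def b'_def)
qed

section \<open>Smoothness in the parameter and the Toda equations\<close>

text \<open>A common degree bound N makes \<open>L s (F s)\<close> a fixed finite sum of
  coefficients times moments, to which the product rule applies; differentiating the moments gives
  the term with the extra factor x.\<close>

lemma has_derivative_L:
  assumes F: "coeffwise_derivative F F' t" and N: "\<And>s. degree (F s) \<le> N"
  shows "((\<lambda>s. L s (F s)) has_real_derivative L t F' - L t ([:0, 1:] * F t)) (at t)"
proof -
  have coeff0: "coeff F' k = 0" if "k > N" for k
  proof -
    have "coeff (F s) k = 0" for s
      using that N[of s] by (simp add: coeff_eq_0)
    then show ?thesis
      using coeffwise_derivative_coeff[OF F, of k] DERIV_const[of 0 "at t"]
      by (metis (no_types, lifting) DERIV_unique ext)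
  qed
  then have N': "degree F' \<le> N" by (simp add: degree_le)
  have expand: "L s p = (\<Sum>k\<le>N. coeff p k * L s (monom 1 k))"
    "L s ([:0, 1:] * p) = (\<Sum>k\<le>N. coeff p k * L s ([:0, 1:] * monom 1 k))" if "degree p \<le> N" for s p
  proof -
    have p: "p = (\<Sum>k\<le>N. smult (coeff p k) (monom 1 k))"
      using poly_as_sum_of_monoms'[OF that] by (simp add: smult_monom)
    show "L s p = (\<Sum>k\<le>N. coeff p k * L s (monom 1 k))"
      by (subst (1) p) (simp only: L_sum L_smult)
    show "L s ([:0, 1:] * p) = (\<Sum>k\<le>N. coeff p k * L s ([:0, 1:] * monom 1 k))"
      by (subst (1) p) (simp only: sum_distrib_left mult_smult_right L_sum L_smult)
  qed
  have "((\<lambda>s. \<Sum>k\<le>N. coeff (F s) k * L s (monom 1 k)) has_real_derivative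
      (\<Sum>k\<le>N. coeff F' k * L t (monom 1 k) + - L t ([:0, 1:] * monom 1 k) * coeff (F t) k)) (at t)"
    by (intro DERIV_sum DERIV_mult coeffwise_derivative_coeff[OF F] L_deriv)
  moreover have "(\<Sum>k\<le>N. coeff F' k * L t (monom 1 k) + - L t ([:0, 1:] * monom 1 k) * coeff (F t) k)
      = L t F' - L t ([:0, 1:] * F t)"
    unfolding expand[OF N] expand[OF N'] by (simp add: sum.distrib sum_negf sum_subtractf mult_ac)
  ultimately show ?thesis
    by (simp add: expand(1)[OF N])
qed

text \<open>These coefficients are constant, 1 or 0. The derivative of \<open>Q s n\<close>
  therefore has degree below n and is orthogonal to \<open>Q s n\<close>.\<close>

lemma coeff_derivative_Q:
  assumes "coeffwise_derivative (\<lambda>s. Q s n) D t" "k \<ge> n"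
  shows "coeff D k = 0"
proof -
  have "(\<lambda>s. coeff (Q s n) k) = (\<lambda>s. if k = n then 1 else 0)"
    using assms(2) by (auto simp: monic_Q coeff_Q_above)
  then show ?thesis
    using coeffwise_derivative_coeff[OF assms(1), of k] DERIV_const DERIV_unique by metis
qed

text \<open>Both terms that differentiate a factor \<open>Q s n\<close> vanish by orthogonality.
  Differentiability of \<open>Q s n\<close> stays a hypothesis because the lemma is applied within
  the induction that proves it.\<close>

lemma h_derivative_if:
  assumes D: "coeffwise_derivative (\<lambda>s. Q s n) D t"
  shows "((\<lambda>s. h s n) has_real_derivative - \<alpha> t n * h t n) (at t)"
proof -
  have "((\<lambda>s. L s (Q s n * Q s n)) has_real_derivative
      L t (D * Q t n + Q t n * D) - L t ([:0, 1:] * (Q t n * Q t n))) (at t)"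
    using degree_mult_le[of "Q _ n" "Q _ n"]
    by (intro has_derivative_L[where N = "n + n"] coeffwise_derivative_mult D) (simp add: degree_Q)
  moreover have "L t (Q t n * D) = 0"
    by (intro L_Q_lower coeff_derivative_Q[OF D])
  ultimately show ?thesis
    unfolding L_add mult.commute[of D] using L_X_Q_Q[of t n] by (simp add: L_Q mult_ac)
qed

text \<open>Strong induction along \<open>three_term\<close>: \<alpha> and \<beta> at index m are
  quotients built from \<open>L\<close>, \<open>h\<close> and polynomials of index at most m, all
  differentiable already.\<close>

lemma Q_differentiable: "\<exists>D. \<forall>t. coeffwise_derivative (\<lambda>s. Q s n) (D t) t"
proof (induction n rule: less_induct)
  case (less n)
  show ?case
  proof (cases n)
    case 0
    have "Q s 0 = 1" for s
      using degree_eq_zeroE[OF degree_Q[of s 0]] monic_Q[of s 0] by (metis coeff_pCons_0 one_pCons)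
    then show ?thesis using coeffwise_derivative_const 0 by fastforce
  next
    case (Suc m)
    obtain D where D: "\<And>t. coeffwise_derivative (\<lambda>s. Q s m) (D t) t"
      using less[of m] Suc by auto
    obtain E where E: "\<And>t. coeffwise_derivative (\<lambda>s. Q s (m - 1)) (E t) t"
      using less[of "m - 1"] Suc by (metis diff_le_self le_imp_less_Suc)
    have "\<exists>G. coeffwise_derivative (\<lambda>s. Q s n) G t" for t
    proof -
      have deg: "degree ([:0, 1:] * Q s m * Q s m) \<le> 1 + m + m" for s
        by (metis (no_types, opaque_lifting) degree_mult_le degree_Q add_mono le_trans le_refl degree_pCons_eq_if degree_0 One_nat_def one_neq_zero zero_neq_one pCons_eq_0_iff)
      obtain a where "((\<lambda>s. L s ([:0, 1:] * Q s m * Q s m)) has_real_derivative a) (at t)"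
        using has_derivative_L[OF coeffwise_derivative_mult[OF coeffwise_derivative_mult[OF
            coeffwise_derivative_const D] D] deg] by blast
      then have "\<exists>a'. ((\<lambda>s. \<alpha> s m) has_real_derivative a') (at t)"
        unfolding \<alpha>_def using DERIV_divide[OF _ h_derivative_if[OF D] h_nonzero] by blast
      then obtain a' where a': "((\<lambda>s. \<alpha> s m) has_real_derivative a') (at t)" ..
      have "\<exists>b'. ((\<lambda>s. \<beta> s m) has_real_derivative b') (at t)"
        using DERIV_divide[OF h_derivative_if[OF D] h_derivative_if[OF E] h_nonzero]
        by (cases "m = 0") (auto simp: \<beta>_def intro: exI DERIV_const)
      then obtain b' where b': "((\<lambda>s. \<beta> s m) has_real_derivative b') (at t)" ..
      have eq: "Q s n = [:0, 1:] * Q s m - smult (\<alpha> s m) (Q s m) - smult (\<beta> s m) (Q s (m - 1))" for s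
        unfolding three_term Suc by simp
      show ?thesis
        unfolding eq
        by (rule exI, rule coeffwise_derivative_diff[OF coeffwise_derivative_diff[OF
            coeffwise_derivative_mult[OF coeffwise_derivative_const D]
            coeffwise_derivative_smult[OF a' D]] coeffwise_derivative_smult[OF b' E]])
    qed
    then show ?thesis by metis
  qed
qed

lemma toda_h: "((\<lambda>s. h s n) has_real_derivative - \<alpha> t n * h t n) (at t)"
  using Q_differentiable h_derivative_if by blast

text \<open>The quotient rule applied to two instances of \<open>toda_h\<close>; at n = 0 both sides
  are 0.\<close>

lemma toda_\<beta>:
  "((\<lambda>s. \<beta> s n) has_real_derivative \<beta> t n * (\<alpha> t (n - 1) - \<alpha> t n)) (at t)"
proof (cases n)
  case (Suc m)
  have "((\<lambda>s. h s n / h s m) has_real_derivative h t n / h t m * (\<alpha> t m - \<alpha> t n)) (at t)"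
    by (rule DERIV_cong[OF DERIV_divide[OF toda_h toda_h h_nonzero]])
      (simp add: h_nonzero field_simps)
  then show ?thesis
    by (simp add: \<beta>_def Suc)
qed simp

text \<open>Differentiate the orthogonality relation between consecutive polynomials.\<close>

lemma coeff_Q_subleading_derivative:
  "((\<lambda>s. coeff (Q s (Suc n)) n) has_real_derivative \<beta> t (Suc n)) (at t)"
proof -
  obtain D where D: "coeffwise_derivative (\<lambda>s. Q s (Suc n)) D t"
    using Q_differentiable by blast
  obtain E where E: "coeffwise_derivative (\<lambda>s. Q s n) E t"
    using Q_differentiable by blast
  have "((\<lambda>s. L s (Q s (Suc n) * Q s n)) has_real_derivative
      L t (D * Q t n + Q t (Suc n) * E) - L t ([:0, 1:] * (Q t (Suc n) * Q t n))) (at t)"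
    using degree_mult_le[of "Q _ (Suc n)" "Q _ n"]
    by (intro has_derivative_L[where N = "Suc n + n"] coeffwise_derivative_mult D E) (simp add: degree_Q)
  moreover have "(\<lambda>s. L s (Q s (Suc n) * Q s n)) = (\<lambda>s. 0)"
    by (simp add: L_Q)
  ultimately have "L t (D * Q t n + Q t (Suc n) * E) - L t ([:0, 1:] * (Q t (Suc n) * Q t n)) = 0"
    using DERIV_const DERIV_unique by metis
  moreover have "L t (Q t (Suc n) * E) = 0"
    using coeff_derivative_Q[OF E] by (intro L_Q_lower) auto
  moreover have "L t (Q t n * D) = coeff D n * h t n"
    using coeff_derivative_Q[OF D] by (intro L_Q_top) auto
  moreover have "L t ([:0, 1:] * (Q t (Suc n) * Q t n)) = h t (Suc n)"
    using L_X_Q_Suc[of t n] by (simp only: mult_ac)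
  ultimately have "coeff D n * h t n = h t (Suc n)"
    by (simp add: L_add mult_ac)
  then have "coeff D n = \<beta> t (Suc n)"
    using \<beta>_Suc_mult[of t n] h_nonzero by (metis mult_right_cancel)
  then show ?thesis
    using coeffwise_derivative_coeff[OF D, of n] by simp
qed

text \<open>\<alpha> is a difference of consecutive subleading coefficients, whose derivatives are
  known.\<close>

lemma toda_\<alpha>: "((\<lambda>s. \<alpha> s n) has_real_derivative \<beta> t n - \<beta> t (Suc n)) (at t)"
proof (cases n)
  case 0
  have "(\<lambda>s. \<alpha> s n) = (\<lambda>s. - coeff (Q s (Suc n)) n)"
    using coeff_Q_subleading[of _ n] 0 by auto
  then show ?thesis
    using DERIV_minus[OF coeff_Q_subleading_derivative[of n t]] 0 by simp
next
  case (Suc m)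
  have "(\<lambda>s. \<alpha> s n) = (\<lambda>s. coeff (Q s (Suc m)) m - coeff (Q s (Suc n)) n)"
    using coeff_Q_subleading[of _ n] Suc by auto
  then show ?thesis
    using DERIV_diff[OF coeff_Q_subleading_derivative[of m t] coeff_Q_subleading_derivative[of n t]] Suc
    by simp
qed

section \<open>Identification of R and elimination to Painleve IV\<close>

text \<open>The left-hand side is the value that integration by parts gives to the scaled Cauchy
  integral of the squared polynomial. Only the factor 2 x + s contributes, since the derivative of
  \<open>Q s n\<close> is orthogonal to \<open>Q s n\<close>.\<close>

lemma L_ladder:
  "- L s (pderiv (Q s n * Q s n) - [:s, 2:] * (Q s n * Q s n)) = (2 * \<alpha> s n + s) * h s n"
proof -
  have "[:s, 2:] * (Q s n * Q s n) = smult s (Q s n * Q s n) + smult 2 ([:0, 1:] * Q s n * Q s n)"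
    by (rule poly_eq_poly_eq_iff[THEN iffD1]) (auto simp: fun_eq_iff algebra_simps)
  then have "L s ([:s, 2:] * (Q s n * Q s n)) = (2 * \<alpha> s n + s) * h s n"
    by (simp only: L_add L_smult L_X_Q_Q L_Q) (simp add: algebra_simps)
  moreover have "L s (Q s n * pderiv (Q s n)) = 0"
    by (intro L_Q_lower) (simp add: coeff_pderiv coeff_Q_above)
  then have "L s (pderiv (Q s n * Q s n)) = 0"
    by (simp only: pderiv_mult L_add mult.commute[of "pderiv _"])
  ultimately show ?thesis
    by (simp only: L_diff)
qed

text \<open>Both derivatives exist at every s; only the final division by R needs R nonzero.\<close>

lemma painleve_ode:
  fixes n :: nat
  defines "R \<equiv> (\<lambda>s. 2 * \<alpha> s n + s)"
  obtains R1 R2 where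
    "\<And>s. (R has_real_derivative R1 s) (at s)"
    "\<And>s. (R1 has_real_derivative R2 s) (at s)"
    "\<And>s. R s \<noteq> 0 \<Longrightarrow> R2 s = (R1 s)\<^sup>2 / (2 * R s) + 3 / 8 * (R s) ^ 3 - s / 2 * (R s)\<^sup>2
       + 1 / 8 * (s\<^sup>2 - 8 * real n - 4 - 4 * \<gamma>) * R s - \<gamma>\<^sup>2 / (2 * R s)"
proof
  \<comment> \<open>The Toda derivative 1 + 2 (\<beta>(n) - \<beta>(n+1)) with \<beta>(n+1)
    eliminated by \<open>discrete_first\<close> and \<alpha>(n) written as (R - s) / 2.
    Differentiating this form brings in only \<alpha>(n-1) as a new unknown.\<close>
  define R1 where "R1 s = 4 * \<beta> s n - 2 * n - \<gamma> + R s * (R s - s) / 2" for s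
  have R1_alt: "R1 s = 1 + 2 * (\<beta> s n - \<beta> s (Suc n))" for s
    using discrete_first[of s n] by (simp add: R1_def R_def field_simps)
  define R2 where "R2 s = 4 * (\<beta> s n * (\<alpha> s (n - 1) - \<alpha> s n)) + (R1 s * (R s - s) + R s * (R1 s - 1)) / 2" for s
  show R': "(R has_real_derivative R1 s) (at s)" for s
    unfolding R1_alt unfolding R_def by (auto intro!: derivative_eq_intros toda_\<alpha>)
  show "(R1 has_real_derivative R2 s) (at s)" for s
    unfolding R2_def by (subst R1_def[abs_def])
      (auto intro!: derivative_eq_intros toda_\<beta> R' simp: field_simps)
  show "R2 s = (R1 s)\<^sup>2 / (2 * R s) + 3 / 8 * (R s) ^ 3 - s / 2 * (R s)\<^sup>2
       + 1 / 8 * (s\<^sup>2 - 8 * real n - 4 - 4 * \<gamma>) * R s - \<gamma>\<^sup>2 / (2 * R s)" if "R s \<noteq> 0" for s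
  proof -
    define b r1 r where "b = \<beta> s n" and "r1 = R1 s" and "r = R s"
    have r0: "r \<noteq> 0"
      using that by (simp add: r_def)
    have b: "b = (r1 + 2 * n + \<gamma> - r * (r - s) / 2) / 4"
      by (simp add: b_def r1_def r_def R1_def)
    have snd: "b * r * (2 * \<alpha> s (n - 1) + s) = (2 * b - n) * (2 * b - n - \<gamma>)"
      using discrete_second[of s n] by (simp add: b_def r_def R_def)
    \<comment> \<open>Multiplication by 2 r produces the product that \<open>discrete_second\<close>
      evaluates, which removes \<alpha>(n-1). What is left contains only b, solved from R1.\<close>
    have "2 * r * R2 s = 4 * (b * r * (2 * \<alpha> s (n - 1) + s)) - 4 * b * r\<^sup>2 + r * (r1 * (r - s) + r * (r1 - 1))"
      by (simp add: R2_def b_def r_def R_def r1_def field_simps power2_eq_square)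
    also have "\<dots> = r1\<^sup>2 + 3 / 4 * r ^ 4 - s * r ^ 3 + (s\<^sup>2 / 4 - 2 * n - 1 - \<gamma>) * r\<^sup>2 - \<gamma>\<^sup>2"
        unfolding snd unfolding b by (simp add: field_simps power2_eq_square power3_eq_cube power4_eq_xxxx)
    finally have "2 * r * R2 s = r1\<^sup>2 + 3 / 4 * r ^ 4 - s * r ^ 3 + (s\<^sup>2 / 4 - 2 * n - 1 - \<gamma>) * r\<^sup>2 - \<gamma>\<^sup>2" .
    moreover have "R2 s = 2 * r * R2 s / (2 * r)"
      using r0 by simp
    ultimately have "R2 s = (r1\<^sup>2 + 3 / 4 * r ^ 4 - s * r ^ 3 + (s\<^sup>2 / 4 - 2 * n - 1 - \<gamma>) * r\<^sup>2 - \<gamma>\<^sup>2) / (2 * r)"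
      by (simp only:)
    also have "\<dots> = r1\<^sup>2 / (2 * r) + 3 / 8 * r ^ 3 - s / 2 * r\<^sup>2
        + 1 / 8 * (s\<^sup>2 - 8 * real n - 4 - 4 * \<gamma>) * r - \<gamma>\<^sup>2 / (2 * r)"
      using r0 by (simp add: add_divide_distrib diff_divide_distrib power2_eq_square
          power3_eq_cube power4_eq_xxxx algebra_simps)
    finally show ?thesis
      by (simp only: r_def r1_def)
  qed
qed

end

section \<open>The moment functional of the shifted weight\<close>

definition shifted_weight :: "real \<Rightarrow> real \<Rightarrow> real \<Rightarrow> real \<Rightarrow> real \<Rightarrow> real" where
  "shifted_weight \<gamma> A B s x =
     exp (- (x\<^sup>2) - s * x) * \<bar>x\<bar> powr \<gamma> * (A + B * heaviside x)"

definition moment_functional :: "real \<Rightarrow> real \<Rightarrow> real \<Rightarrow> real \<Rightarrow> real poly \<Rightarrow> real" where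
  "moment_functional \<gamma> A B s p = (LINT x|lborel. poly p x * shifted_weight \<gamma> A B s x)"

lemma weight_shift: "weight \<gamma> A B s (s + x) = shifted_weight \<gamma> A B s x"
proof -
  have "- ((s + x)\<^sup>2) + s * (s + x) = - (x\<^sup>2) - s * x"
    by (simp add: algebra_simps power2_eq_square)
  then show ?thesis
    by (simp add: weight_def shifted_weight_def)
qed

lemma lborel_integral_shift: "(LINT z|lborel. f z) = (LINT x|lborel. f (s + x))" for f :: "real \<Rightarrow> real"
  using lborel_integral_real_affine[of 1 f s] by simp

lemma heaviside_measurable [measurable]: "heaviside \<in> borel_measurable borel"
  unfolding heaviside_def[abs_def] by measurable

lemma shifted_weight_measurable [measurable]: "shifted_weight \<gamma> A B s \<in> borel_measurable borel"
  unfolding shifted_weight_def[abs_def] by measurable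

lemma poly_measurable [measurable]: "poly p \<in> borel_measurable (borel :: real measure)"
  by (intro borel_measurable_continuous_onI continuous_intros)

text \<open>Each coefficient costs one factor |x| \<le> exp |x|. Exponential majorants are
  convenient because the derivative estimate below multiplies polynomials by exp |x|.\<close>

lemma poly_exp_bound: "\<exists>C K. C \<ge> 0 \<and> (\<forall>x::real. \<bar>poly p x\<bar> \<le> C * exp (K * \<bar>x\<bar>))"
proof (induction p)
  case 0
  show ?case by (rule exI[of _ 0]) auto
next
  case (pCons a p)
  then obtain C K where CK: "C \<ge> 0" "\<And>x::real. \<bar>poly p x\<bar> \<le> C * exp (K * \<bar>x\<bar>)"
    by blast
  have "\<bar>poly (pCons a p) x\<bar> \<le> (\<bar>a\<bar> + C) * exp ((\<bar>K\<bar> + 1) * \<bar>x\<bar>)" for x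
  proof -
    have "\<bar>x\<bar> \<le> exp \<bar>x\<bar>"
      using exp_ge_add_one_self[of "\<bar>x\<bar>"] by linarith
    moreover have "C * exp (K * \<bar>x\<bar>) \<le> C * exp (\<bar>K\<bar> * \<bar>x\<bar>)"
      using CK(1) by (intro mult_left_mono) (auto intro: mult_right_mono)
    ultimately have "\<bar>x\<bar> * \<bar>poly p x\<bar> \<le> exp \<bar>x\<bar> * (C * exp (\<bar>K\<bar> * \<bar>x\<bar>))"
      using CK(2)[of x] by (intro mult_mono) auto
    also have "\<dots> = C * exp ((\<bar>K\<bar> + 1) * \<bar>x\<bar>)"
      by (simp add: algebra_simps exp_add)
    finally have "\<bar>x * poly p x\<bar> \<le> C * exp ((\<bar>K\<bar> + 1) * \<bar>x\<bar>)"
      by (simp add: abs_mult)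
    moreover have "\<bar>a\<bar> \<le> \<bar>a\<bar> * exp ((\<bar>K\<bar> + 1) * \<bar>x\<bar>)"
      using mult_left_mono[of 1 "exp ((\<bar>K\<bar> + 1) * \<bar>x\<bar>)" "\<bar>a\<bar>"] by simp
    ultimately show ?thesis
      by (simp add: algebra_simps) linarith
  qed
  then show ?case
    using CK(1) by (intro exI[of _ "\<bar>a\<bar> + C"] exI[of _ "\<bar>K\<bar> + 1"]) auto
qed

text \<open>The positive half-line carries the Gamma integral at a + 1 > 0; the negative one follows
  by reflection.\<close>

lemma integrable_abs_powr_exp:
  assumes "a > -1"
  shows "integrable lborel (\<lambda>x::real. \<bar>x\<bar> powr a * exp (- \<bar>x\<bar>))"
proof -
  have "integrable lborel (\<lambda>t. indicator {0..} t * t powr a / exp t)"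
  proof (rule integrableI_nonneg)
    have "(\<integral>\<^sup>+ t. ennreal (indicator {0..} t * t powr a / exp t) \<partial>lborel) = ennreal (Gamma (a + 1))"
      using Gamma_conv_nn_integral_real[of "a + 1"] assms by simp
    then show "(\<integral>\<^sup>+ t. ennreal (indicator {0..} t * t powr a / exp t) \<partial>lborel) < \<infinity>"
      by simp
  qed auto
  then have pos: "integrable lborel (\<lambda>t. indicator {0..} t * (\<bar>t\<bar> powr a * exp (- \<bar>t\<bar>)))"
    by (rule Bochner_Integration.integrable_cong[THEN iffD1, rotated 2])
      (auto simp: indicator_def exp_minus divide_simps)
  have neg: "integrable lborel (\<lambda>t. indicator {0..} (0 + (-1) * t) * (\<bar>0 + (-1) * t\<bar> powr a * exp (- \<bar>0 + (-1) * t\<bar>)))"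
    by (rule lborel_integrable_real_affine[OF pos]) simp
  show ?thesis
    by (rule Bochner_Integration.integrable_bound[OF Bochner_Integration.integrable_add[OF pos neg]])
      (auto simp: indicator_def)
qed

text \<open>With m = |s| + K + 1, the square of m - |x| / 2 shows m |x| \<le> m^2 + x^2 for either
  sign of m. The Gaussian thus absorbs all exponentials and leaves a spare exp (- |x|).\<close>

lemma gauss_exp_bound:
  "exp (K * \<bar>x\<bar>) * exp (- (x\<^sup>2) - s * x) \<le> exp ((\<bar>s\<bar> + K + 1)\<^sup>2) * exp (- \<bar>x\<bar>)" for x :: real
proof -
  have "- (s * x) \<le> \<bar>s\<bar> * \<bar>x\<bar>"
    by (metis abs_ge_minus_self abs_mult)
  moreover have "(\<bar>s\<bar> + K + 1) * \<bar>x\<bar> \<le> (\<bar>s\<bar> + K + 1)\<^sup>2 + x\<^sup>2"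
  proof -
    have "0 \<le> (\<bar>s\<bar> + K + 1 - \<bar>x\<bar> / 2)\<^sup>2 + 3 / 4 * \<bar>x\<bar>\<^sup>2" by simp
    then show ?thesis by (simp add: power2_eq_square algebra_simps)
  qed
  ultimately have "K * \<bar>x\<bar> + (- (x\<^sup>2) - s * x) \<le> (\<bar>s\<bar> + K + 1)\<^sup>2 + - \<bar>x\<bar>"
    by (simp add: algebra_simps)
  then show ?thesis
    by (simp flip: exp_add)
qed

lemma integrable_shifted_weight:
  assumes "\<gamma> > -1" and [measurable]: "f \<in> borel_measurable borel"
    and bound: "\<And>x. \<bar>f x\<bar> \<le> C * exp (K * \<bar>x\<bar>)"
  shows "integrable lborel (\<lambda>x. f x * shifted_weight \<gamma> A B s x)"
proof (rule Bochner_Integration.integrable_bound)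
  define M where "M = C * exp ((\<bar>s\<bar> + K + 1)\<^sup>2) * (\<bar>A\<bar> + \<bar>B\<bar>)"
  show "integrable lborel (\<lambda>x. M * (\<bar>x\<bar> powr \<gamma> * exp (- \<bar>x\<bar>)))"
    using integrable_abs_powr_exp[OF assms(1)] by (rule integrable_mult_right)
  show "AE x in lborel. norm (f x * shifted_weight \<gamma> A B s x) \<le> norm (M * (\<bar>x\<bar> powr \<gamma> * exp (- \<bar>x\<bar>)))"
  proof (rule AE_I2)
    fix x
    have "0 \<le> C * exp (K * \<bar>x\<bar>)"
      using bound[of x] by linarith
    then have C: "C \<ge> 0"
      by (simp add: zero_le_mult_iff)
    have "\<bar>f x\<bar> * exp (- (x\<^sup>2) - s * x) \<le> C * (exp (K * \<bar>x\<bar>) * exp (- (x\<^sup>2) - s * x))"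
      using bound[of x] by (simp add: mult_right_mono flip: mult.assoc)
    also have "\<dots> \<le> C * (exp ((\<bar>s\<bar> + K + 1)\<^sup>2) * exp (- \<bar>x\<bar>))"
      by (rule mult_left_mono[OF gauss_exp_bound C])
    finally have 1: "\<bar>f x\<bar> * exp (- (x\<^sup>2) - s * x) \<le> C * (exp ((\<bar>s\<bar> + K + 1)\<^sup>2) * exp (- \<bar>x\<bar>))" .
    have 2: "\<bar>A + B * heaviside x\<bar> \<le> \<bar>A\<bar> + \<bar>B\<bar>"
      by (auto simp: heaviside_def)
    have "norm (f x * shifted_weight \<gamma> A B s x) =
        (\<bar>f x\<bar> * exp (- (x\<^sup>2) - s * x)) * \<bar>A + B * heaviside x\<bar> * \<bar>x\<bar> powr \<gamma>"
      by (simp add: shifted_weight_def abs_mult)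
    also have "\<dots> \<le> (C * (exp ((\<bar>s\<bar> + K + 1)\<^sup>2) * exp (- \<bar>x\<bar>))) * (\<bar>A\<bar> + \<bar>B\<bar>) * \<bar>x\<bar> powr \<gamma>"
      using C by (intro mult_right_mono mult_mono 1 2) auto
    also have "\<dots> = M * (\<bar>x\<bar> powr \<gamma> * exp (- \<bar>x\<bar>))"
      by (simp add: M_def)
    finally show "norm (f x * shifted_weight \<gamma> A B s x) \<le> norm (M * (\<bar>x\<bar> powr \<gamma> * exp (- \<bar>x\<bar>)))"
      by simp
  qed
qed measurable

lemma integrable_poly_shifted_weight:
  assumes "\<gamma> > -1"
  shows "integrable lborel (\<lambda>x. poly p x * shifted_weight \<gamma> A B s x)"
  using poly_exp_bound[of p] by (auto intro: integrable_shifted_weight[OF assms])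

lemma moment_functional_add:
  "\<gamma> > -1 \<Longrightarrow> moment_functional \<gamma> A B s (p + q) = moment_functional \<gamma> A B s p + moment_functional \<gamma> A B s q"
  unfolding moment_functional_def
  by (simp add: distrib_right integrable_poly_shifted_weight)

lemma moment_functional_smult:
  "moment_functional \<gamma> A B s (smult c p) = c * moment_functional \<gamma> A B s p"
  unfolding moment_functional_def by (simp add: mult.assoc)

section \<open>Differentiation of the moments under the integral sign\<close>

lemma abs_exp_minus_linear_le: "\<bar>exp y - 1 - y\<bar> \<le> y\<^sup>2 * exp \<bar>y\<bar>" for y :: real
proof -
  obtain c where c: "\<bar>c\<bar> \<le> \<bar>y\<bar>" "exp y = (\<Sum>m<2. y ^ m / fact m) + exp c / fact 2 * y ^ 2"
    using Maclaurin_exp_le by blast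
  have "exp y - 1 - y = exp c / 2 * y\<^sup>2"
    using c(2) by (simp add: numeral_2_eq_2)
  moreover have bound: "exp c / 2 \<le> exp \<bar>y\<bar>"
    using c(1) by (smt (verit) exp_le_cancel_iff exp_gt_zero field_sum_of_halves)
  ultimately have "\<bar>exp y - 1 - y\<bar> = exp c / 2 * y\<^sup>2"
    by (simp only: abs_mult abs_power2 abs_divide abs_exp_cancel abs_numeral)
  also have "\<dots> \<le> exp \<bar>y\<bar> * y\<^sup>2"
    using bound by (rule mult_right_mono) simp
  finally show ?thesis
    by (simp only: mult.commute)
qed

text \<open>Dividing by s - t leaves an error of at most M |s - t|. A quadratic estimate thus
  replaces a limit exchange under the integral.\<close>

lemma has_real_derivative_quadratic_error:
  fixes f :: "real \<Rightarrow> real"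
  assumes "\<And>s. \<bar>s - t\<bar> \<le> 1 \<Longrightarrow> \<bar>f s - f t - (s - t) * D\<bar> \<le> M * (s - t)\<^sup>2"
  shows "(f has_real_derivative D) (at t)"
  unfolding has_field_derivative_iff
proof (rule Lim_transform)
  show "((\<lambda>s. D) \<longlongrightarrow> D) (at t)" by simp
  show "((\<lambda>s. (f s - f t) / (s - t) - D) \<longlongrightarrow> 0) (at t)"
  proof (rule Lim_null_comparison)
    have "((\<lambda>s. M * \<bar>s - t\<bar>) \<longlongrightarrow> M * \<bar>t - t\<bar>) (at t)"
      by (intro tendsto_intros)
    then show "((\<lambda>s. M * \<bar>s - t\<bar>) \<longlongrightarrow> 0) (at t)" by simp
    have "eventually (\<lambda>s. dist s t < 1) (at t)"
      unfolding eventually_at by (intro exI[of _ 1]) auto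
    moreover have "eventually (\<lambda>s. s \<noteq> t) (at t)"
      by (simp add: eventually_at_filter)
    ultimately show "\<forall>\<^sub>F s in at t. norm ((f s - f t) / (s - t) - D) \<le> M * \<bar>s - t\<bar>"
    proof eventually_elim
      case (elim s)
      have "norm ((f s - f t) / (s - t) - D) = \<bar>f s - f t - (s - t) * D\<bar> / \<bar>s - t\<bar>"
      proof -
        have "(f s - f t) / (s - t) - D = (f s - f t - (s - t) * D) / (s - t)"
          using elim by (simp add: field_simps)
        then show ?thesis by simp
      qed
      also have "\<dots> \<le> M * (s - t)\<^sup>2 / \<bar>s - t\<bar>"
        using assms[of s] elim by (intro divide_right_mono) (auto simp: dist_real_def)
      also have "\<dots> = M * \<bar>s - t\<bar>"
        using elim by (simp add: power2_eq_square field_simps abs_if)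
      finally show ?case .
    qed
  qed
qed

text \<open>With y = - (s - t) x the weights at s and t differ by the factor exp y. Its second-order
  Taylor remainder is of size (s - t)^2 x^2 exp |x| when |s - t| \<le> 1, and N is the resulting
  integrable majorant.\<close>

lemma moment_functional_has_derivative:
  assumes "\<gamma> > -1"
  shows "((\<lambda>s. moment_functional \<gamma> A B s p) has_real_derivative
    - moment_functional \<gamma> A B t ([:0, 1:] * p)) (at t)"
proof -
  obtain C K where CK: "C \<ge> 0" "\<And>x. \<bar>poly ([:0, 0, 1:] * p) x\<bar> \<le> C * exp (K * \<bar>x\<bar>)"
    using poly_exp_bound by blast
  define N where "N x = (\<bar>poly ([:0, 0, 1:] * p) x\<bar> * exp \<bar>x\<bar>) * \<bar>shifted_weight \<gamma> A B t x\<bar>" for x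
  have "integrable lborel (\<lambda>x. (\<bar>poly ([:0, 0, 1:] * p) x\<bar> * exp \<bar>x\<bar>) * shifted_weight \<gamma> A B t x)"
  proof (rule integrable_shifted_weight[OF assms])
    show "\<bar>\<bar>poly ([:0, 0, 1:] * p) x\<bar> * exp \<bar>x\<bar>\<bar> \<le> C * exp ((K + 1) * \<bar>x\<bar>)" for x
      using mult_right_mono[OF CK(2), of "exp \<bar>x\<bar>" x] by (simp add: distrib_right exp_add abs_mult)
  qed measurable
  from integrable_abs[OF this] have N: "integrable lborel N"
    by (simp add: N_def[abs_def] abs_mult)
  show ?thesis
  proof (rule has_real_derivative_quadratic_error)
    fix s assume s: "\<bar>s - t\<bar> \<le> 1"
    have "moment_functional \<gamma> A B s p - moment_functional \<gamma> A B t p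
        - (s - t) * - moment_functional \<gamma> A B t ([:0, 1:] * p) =
        (LINT x|lborel. poly p x * shifted_weight \<gamma> A B s x - poly p x * shifted_weight \<gamma> A B t x
          + (s - t) * (poly ([:0, 1:] * p) x * shifted_weight \<gamma> A B t x))"
      unfolding moment_functional_def
      by (simp only: Bochner_Integration.integral_add Bochner_Integration.integral_diff
          integral_mult_right_zero integrable_poly_shifted_weight[OF assms]
          Bochner_Integration.integrable_diff integrable_mult_right
          mult_minus_right minus_minus diff_minus_eq_add)
    moreover have "\<bar>LINT x|lborel. poly p x * shifted_weight \<gamma> A B s x - poly p x * shifted_weight \<gamma> A B t x
          + (s - t) * (poly ([:0, 1:] * p) x * shifted_weight \<gamma> A B t x)\<bar> \<le> (LINT x|lborel. (s - t)\<^sup>2 * N x)"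
    proof (rule integral_abs_bound_integral)
      show "integrable lborel (\<lambda>x. poly p x * shifted_weight \<gamma> A B s x - poly p x * shifted_weight \<gamma> A B t x
        + (s - t) * (poly ([:0, 1:] * p) x * shifted_weight \<gamma> A B t x))"
        by (intro Bochner_Integration.integrable_add Bochner_Integration.integrable_diff
            integrable_mult_right integrable_poly_shifted_weight assms)
      show "integrable lborel (\<lambda>x. (s - t)\<^sup>2 * N x)"
        by (intro integrable_mult_right N)
      fix x
      define y where "y = - ((s - t) * x)"
      have "- (x\<^sup>2) - s * x = (- (x\<^sup>2) - t * x) + y"
        by (simp add: y_def algebra_simps)
      then have "shifted_weight \<gamma> A B s x = exp y * shifted_weight \<gamma> A B t x"
        unfolding shifted_weight_def by (simp only: exp_add) simp
      then have eq: "poly p x * shifted_weight \<gamma> A B s x - poly p x * shifted_weight \<gamma> A B t x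
          + (s - t) * (poly ([:0, 1:] * p) x * shifted_weight \<gamma> A B t x) =
          poly p x * shifted_weight \<gamma> A B t x * (exp y - 1 - y)"
        by (simp add: y_def algebra_simps)
      have "\<bar>poly p x * shifted_weight \<gamma> A B t x * (exp y - 1 - y)\<bar> \<le> \<bar>poly p x\<bar> * \<bar>shifted_weight \<gamma> A B t x\<bar> * (y\<^sup>2 * exp \<bar>x\<bar>)"
      proof -
        have "\<bar>y\<bar> \<le> \<bar>x\<bar>"
          using mult_right_mono[OF s, of "\<bar>x\<bar>"] by (simp add: y_def abs_mult)
        then have "y\<^sup>2 * exp \<bar>y\<bar> \<le> y\<^sup>2 * exp \<bar>x\<bar>"
          by (intro mult_left_mono) auto
        then have "\<bar>exp y - 1 - y\<bar> \<le> y\<^sup>2 * exp \<bar>x\<bar>"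
          using abs_exp_minus_linear_le[of y] by linarith
        then show ?thesis
          unfolding abs_mult by (intro mult_left_mono) auto
      qed
      also have "\<dots> = (s - t)\<^sup>2 * N x"
        by (simp add: N_def y_def abs_mult power2_eq_square)
      finally show "\<bar>poly p x * shifted_weight \<gamma> A B s x - poly p x * shifted_weight \<gamma> A B t x
          + (s - t) * (poly ([:0, 1:] * p) x * shifted_weight \<gamma> A B t x)\<bar> \<le> (s - t)\<^sup>2 * N x"
        by (simp only: eq)
    qed
    moreover have "(LINT x|lborel. (s - t)\<^sup>2 * N x) = (LINT x|lborel. N x) * (s - t)\<^sup>2"
      by (subst integral_mult_right_zero) (rule mult.commute)
    ultimately show "\<bar>moment_functional \<gamma> A B s p - moment_functional \<gamma> A B t p
        - (s - t) * - moment_functional \<gamma> A B t ([:0, 1:] * p)\<bar> \<le> (LINT x|lborel. N x) * (s - t)\<^sup>2"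
      by (simp only:)
  qed
qed

section \<open>Positivity of the norms\<close>

text \<open>A nonnegative integrand with integral 0 vanishes almost everywhere. Away from 0 and the
  finitely many roots of p this forces the step factor to vanish, but it is B on (0, 1) if A = 0 and
  A on (-1, 0) otherwise.\<close>

lemma moment_functional_square_nonzero:
  assumes "\<gamma> > -1" "A \<ge> 0" "A + B \<ge> 0" "A \<noteq> 0 \<or> B \<noteq> 0" "p \<noteq> 0"
  shows "moment_functional \<gamma> A B s (p * p) \<noteq> 0"
proof
  define f where "f x = poly (p * p) x * shifted_weight \<gamma> A B s x" for x
  assume "moment_functional \<gamma> A B s (p * p) = 0"
  then have "(LINT x|lborel. f x) = 0"
    by (simp add: moment_functional_def f_def)
  moreover have "f x \<ge> 0" for x
    using assms(2,3) by (auto simp: f_def shifted_weight_def heaviside_def)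
  ultimately have "AE x in lborel. f x = 0"
    using integral_nonneg_eq_0_iff_AE[of lborel f] integrable_poly_shifted_weight[OF assms(1)]
    by (auto simp: f_def[abs_def] simp del: poly_mult)
  moreover have "AE x in lborel. x \<notin> insert 0 {x. poly p x = 0}"
    using poly_roots_finite[OF assms(5)]
    by (intro AE_not_in finite_imp_null_set_lborel) simp
  ultimately have ae: "AE x in lborel. A + B * heaviside x = 0"
    by eventually_elim (auto simp: f_def shifted_weight_def)
  have contra: False if "u < v" "\<And>x. x \<in> {u<..<v} \<Longrightarrow> A + B * heaviside x \<noteq> 0" for u v
  proof -
    have "AE x in lborel. x \<notin> {u<..<v}"
      using ae by eventually_elim (use that in auto)
    then have "{u<..<v} \<in> null_sets lborel"
      by (subst AE_iff_null_sets) auto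
    then have "emeasure lborel {u<..<v} = 0"
      by (rule null_setsD1)
    then show False using that(1) by simp
  qed
  show False
  proof (cases "A = 0")
    case True
    then show False
      using contra[of 0 1] assms(4) by (auto simp: heaviside_def)
  next
    case False
    then show False
      using contra[of "-1" 0] by (auto simp: heaviside_def)
  qed
qed

section \<open>Truncated integrals, integration by parts and the finite part\<close>

text \<open>Dominated convergence after the substitution \<epsilon> = 1 / k. The value
  \<open>f 0 = 0\<close> gives pointwise convergence at 0, a point that no truncated domain with
  \<epsilon> > 0 contains.\<close>

lemma truncated_integral_tendsto:
  fixes f :: "real \<Rightarrow> real"
  assumes "integrable lborel f" "f 0 = 0"
  shows "((\<lambda>\<epsilon>. LINT x:{x. \<bar>x\<bar> > \<epsilon>}|lborel. f x) \<longlongrightarrow> (LINT x|lborel. f x)) (at_right 0)"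
  unfolding filterlim_at_right_to_top set_lebesgue_integral_def
proof (rule integral_dominated_convergence_at_top)
  note [measurable] = borel_measurable_integrable[OF assms(1)]
  show "f \<in> borel_measurable lborel" by measurable
  show "(\<lambda>x. indicat_real {x. inverse k < \<bar>x\<bar>} x *\<^sub>R f x) \<in> borel_measurable lborel" for k :: real
    by measurable
  show "integrable lborel (\<lambda>x. \<bar>f x\<bar>)"
    using assms(1) by simp
  show "\<forall>\<^sub>F k in at_top. AE x in lborel. norm (indicat_real {x. inverse k < \<bar>x\<bar>} x *\<^sub>R f x) \<le> \<bar>f x\<bar>"
    by (auto simp: indicator_def)
  show "AE x in lborel. ((\<lambda>k. indicat_real {x. inverse k < \<bar>x\<bar>} x *\<^sub>R f x) \<longlongrightarrow> f x) at_top"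
  proof (rule AE_I2)
    fix x
    show "((\<lambda>k. indicat_real {x. inverse k < \<bar>x\<bar>} x *\<^sub>R f x) \<longlongrightarrow> f x) at_top"
    proof (cases "x = 0")
      case False
      have "eventually (\<lambda>k. inverse k < \<bar>x\<bar>) at_top"
        using eventually_gt_at_top[of "inverse \<bar>x\<bar>"]
      proof eventually_elim
        case (elim k)
        then show ?case
          using False less_imp_inverse_less[OF elim] by simp
      qed
      then have "eventually (\<lambda>k. indicat_real {x. inverse k < \<bar>x\<bar>} x *\<^sub>R f x = f x) at_top"
        by eventually_elim simp
      then show ?thesis
        by (rule tendsto_eventually)
    qed (simp add: assms(2))
  qed
qed


text \<open>Dividing by x covers both signs in one formula and produces the kernel 1 / x of the
  Cauchy integral.\<close>

lemma has_real_derivative_abs_powr: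
  fixes x :: real
  assumes "x \<noteq> 0"
  shows "((\<lambda>x. \<bar>x\<bar> powr \<gamma>) has_real_derivative \<gamma> * \<bar>x\<bar> powr \<gamma> / x) (at x)"
proof (cases "x > 0")
  case True
  have "((\<lambda>x. x powr \<gamma>) has_real_derivative \<gamma> * \<bar>x\<bar> powr \<gamma> / x) (at x)"
    using True by (auto intro!: derivative_eq_intros simp: powr_diff)
  then show ?thesis
    by (rule has_field_derivative_transform_within_open[where S = "{0<..}"]) (use True in auto)
next
  case False
  then have "((\<lambda>x. (- x) powr \<gamma>) has_real_derivative \<gamma> * \<bar>x\<bar> powr \<gamma> / x) (at x)"
    using assms by (auto intro!: derivative_eq_intros simp: powr_diff)
  then show ?thesis
    by (rule has_field_derivative_transform_within_open[where S = "{..<0}"]) (use False assms in auto)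
qed

lemma truncated_integrable:
  assumes "\<gamma> > -1" "\<epsilon> > 0"
  shows "set_integrable lborel {x. \<bar>x\<bar> > \<epsilon>} (\<lambda>x. poly p x * shifted_weight \<gamma> A B s x / x)"
proof -
  obtain C K where CK: "C \<ge> 0" "\<And>x. \<bar>poly p x\<bar> \<le> C * exp (K * \<bar>x\<bar>)"
    using poly_exp_bound by blast
  have "integrable lborel (\<lambda>x. (indicat_real {x. \<bar>x\<bar> > \<epsilon>} x * (poly p x / x)) * shifted_weight \<gamma> A B s x)"
  proof (rule integrable_shifted_weight[OF assms(1)])
    fix x :: real
    have "\<bar>poly p x\<bar> / \<bar>x\<bar> \<le> C * exp (K * \<bar>x\<bar>) / \<epsilon>" if "\<bar>x\<bar> > \<epsilon>"
      using that assms(2) CK by (intro frac_le) auto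
    then show "\<bar>indicat_real {x. \<bar>x\<bar> > \<epsilon>} x * (poly p x / x)\<bar> \<le> (C / \<epsilon>) * exp (K * \<bar>x\<bar>)"
      using CK(1) assms(2) by (auto simp: indicator_def abs_mult)
  qed measurable
  then show ?thesis
    by (simp add: set_integrable_def mult_ac)
qed

text \<open>This removes the boundary terms at infinity in the integration by parts.\<close>

lemma poly_gauss_powr_vanishes:
  fixes p :: "real poly" and s \<gamma> :: real
  assumes "F = at_top \<or> F = at_bot"
  shows "((\<lambda>x. poly p x * (exp (- (x\<^sup>2) - s * x) * \<bar>x\<bar> powr \<gamma>)) \<longlongrightarrow> 0) F"
proof -
  obtain C K where CK: "C \<ge> 0" "\<And>x. \<bar>poly p x\<bar> \<le> C * exp (K * \<bar>x\<bar>)"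
    using poly_exp_bound by blast
  have "\<bar>poly p x\<bar> * (exp (- (x\<^sup>2) - s * x) * \<bar>x\<bar> powr \<gamma>) \<le>
      C * exp ((\<bar>s\<bar> + K + 1)\<^sup>2) * (\<bar>x\<bar> powr \<gamma> * exp (- \<bar>x\<bar>))" for x
  proof -
    have "\<bar>poly p x\<bar> * (exp (- (x\<^sup>2) - s * x) * \<bar>x\<bar> powr \<gamma>) \<le>
        C * exp (K * \<bar>x\<bar>) * (exp (- (x\<^sup>2) - s * x) * \<bar>x\<bar> powr \<gamma>)"
      using CK by (intro mult_right_mono) auto
    also have "\<dots> = C * \<bar>x\<bar> powr \<gamma> * (exp (K * \<bar>x\<bar>) * exp (- (x\<^sup>2) - s * x))"
      by simp
    also have "\<dots> \<le> C * \<bar>x\<bar> powr \<gamma> * (exp ((\<bar>s\<bar> + K + 1)\<^sup>2) * exp (- \<bar>x\<bar>))"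
      using CK(1) by (intro mult_left_mono gauss_exp_bound) auto
    finally show ?thesis by (simp add: mult_ac)
  qed
  then have bound: "\<forall>\<^sub>F x in F. norm (poly p x * (exp (- (x\<^sup>2) - s * x) * \<bar>x\<bar> powr \<gamma>)) \<le>
      C * exp ((\<bar>s\<bar> + K + 1)\<^sup>2) * (\<bar>x\<bar> powr \<gamma> * exp (- \<bar>x\<bar>))"
    by (intro always_eventually) (auto simp: abs_mult)
  have "((\<lambda>x::real. x powr \<gamma> * exp (- x)) \<longlongrightarrow> 0) at_top"
    by real_asymp
  moreover have "filterlim (\<lambda>x::real. \<bar>x\<bar>) at_top F"
  proof -
    have "filterlim (\<lambda>x::real. \<bar>x\<bar>) at_top at_top" "filterlim (\<lambda>x::real. \<bar>x\<bar>) at_top at_bot"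
      by real_asymp+
    then show ?thesis using assms by blast
  qed
  ultimately have "((\<lambda>x. \<bar>x\<bar> powr \<gamma> * exp (- \<bar>x\<bar>)) \<longlongrightarrow> 0) F"
    by (rule filterlim_compose)
  then have "((\<lambda>x. C * exp ((\<bar>s\<bar> + K + 1)\<^sup>2) * (\<bar>x\<bar> powr \<gamma> * exp (- \<bar>x\<bar>))) \<longlongrightarrow> 0) F"
    by (rule tendsto_mult_right_zero)
  with bound show ?thesis
    by (rule Lim_null_comparison)
qed

text \<open>The fundamental theorem is applied to F on each half-line outside
  [-\<epsilon>, \<epsilon>]. In F' the factor |x|^\<gamma> contributes the Cauchy kernel, and the
  other two factors contribute q.\<close>

lemma truncated_by_parts:
  fixes g :: "real poly" and s :: real
  assumes "\<gamma> > -1" "\<epsilon> > 0"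
  defines "q \<equiv> pderiv g - [:s, 2:] * g"
    and "k \<equiv> \<lambda>x. poly g x * exp (- (x\<^sup>2) - s * x)"
  shows "\<gamma> * (LINT x:{x. \<bar>x\<bar> > \<epsilon>}|lborel. poly g x * shifted_weight \<gamma> A B s x / x)
    + (LINT x:{x. \<bar>x\<bar> > \<epsilon>}|lborel. poly q x * shifted_weight \<gamma> A B s x)
    = \<epsilon> powr \<gamma> * (A * k (- \<epsilon>) - (A + B) * k \<epsilon>)"
proof -
  define F where "F x = poly g x * (exp (- (x\<^sup>2) - s * x) * \<bar>x\<bar> powr \<gamma>)" for x
  define f where "f x = (poly q x + \<gamma> * (poly g x / x)) * (exp (- (x\<^sup>2) - s * x) * \<bar>x\<bar> powr \<gamma>)" for x
  have F': "(F has_real_derivative f x) (at x)" if "x \<noteq> 0" for x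
    unfolding F_def[abs_def] f_def q_def
    by (rule derivative_eq_intros has_real_derivative_abs_powr that refl poly_DERIV)+
      (simp add: that field_simps)
  have f: "isCont f x" if "x \<noteq> 0" for x
    unfolding f_def using that by (intro continuous_intros) auto
  have Fcont: "isCont F x" if "x \<noteq> 0" for x
    using F'[OF that] by (rule DERIV_isCont)
  have int_q: "set_integrable lborel {x. \<bar>x\<bar> > \<epsilon>} (\<lambda>x. poly q x * shifted_weight \<gamma> A B s x)" for A B
    unfolding set_integrable_def
    using integrable_poly_shifted_weight[OF assms(1)] by (intro integrable_mult_indicator) auto
  have int_f: "set_integrable lborel {x. \<bar>x\<bar> > \<epsilon>} f"
  proof -
    \<comment> \<open>The parameters 1 and 0 in place of A and B give the weight without its
      step.\<close>
    have "set_integrable lborel {x. \<bar>x\<bar> > \<epsilon>}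
        (\<lambda>x. poly q x * shifted_weight \<gamma> 1 0 s x + \<gamma> * (poly g x * shifted_weight \<gamma> 1 0 s x / x))"
      by (intro set_integral_add(1) set_integrable_mult_right truncated_integrable assms int_q)
    then show ?thesis
      by (simp add: f_def[abs_def] shifted_weight_def algebra_simps)
  qed
  have right: "(LINT x:{\<epsilon><..}|lborel. f x) = - F \<epsilon>"
  proof -
    have "(LBINT x=ereal \<epsilon>..\<infinity>. f x) = 0 - F \<epsilon>"
    proof (rule interval_integral_FTC_integrable)
      show "(F has_vector_derivative f x) (at x)" if "ereal \<epsilon> < ereal x" for x
        using F'[of x] that assms(2) by (simp add: has_real_derivative_iff_has_vector_derivative)
      show "isCont f x" if "ereal \<epsilon> < ereal x" for x
        using f that assms(2) by simp
      show "set_integrable lborel (einterval (ereal \<epsilon>) \<infinity>) f"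
        by (rule set_integrable_subset[OF int_f]) (auto simp: einterval_def)
      show "((F \<circ> real_of_ereal) \<longlongrightarrow> F \<epsilon>) (at_right (ereal \<epsilon>))"
        using Fcont[of \<epsilon>] assms(2)
        by (simp add: ereal_tendsto_simps1 continuous_within isCont_def filterlim_at_split)
      show "((F \<circ> real_of_ereal) \<longlongrightarrow> 0) (at_left \<infinity>)"
        unfolding ereal_tendsto_simps1 F_def by (rule poly_gauss_powr_vanishes) simp
    qed simp
    then show ?thesis
      by (simp add: interval_integral_to_infinity_eq)
  qed
  have left: "(LINT x:{..<-\<epsilon>}|lborel. f x) = F (- \<epsilon>)"
  proof -
    have "(LBINT x=-\<infinity>..ereal (- \<epsilon>). f x) = F (- \<epsilon>) - 0"
    proof (rule interval_integral_FTC_integrable)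
      show "(F has_vector_derivative f x) (at x)" if "ereal x < ereal (- \<epsilon>)" for x
        using F'[of x] that assms(2) by (simp add: has_real_derivative_iff_has_vector_derivative)
      show "isCont f x" if "ereal x < ereal (- \<epsilon>)" for x
        using f that assms(2) by simp
      show "set_integrable lborel (einterval (-\<infinity>) (ereal (- \<epsilon>))) f"
        by (rule set_integrable_subset[OF int_f]) (auto simp: einterval_def)
      show "((F \<circ> real_of_ereal) \<longlongrightarrow> F (- \<epsilon>)) (at_left (ereal (- \<epsilon>)))"
        using Fcont[of "- \<epsilon>"] assms(2)
        by (simp only: ereal_tendsto_simps1) (simp add: isCont_def filterlim_at_split)
      show "((F \<circ> real_of_ereal) \<longlongrightarrow> 0) (at_right (-\<infinity>))"
        unfolding ereal_tendsto_simps1 F_def by (rule poly_gauss_powr_vanishes) simp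
    qed simp
    then show ?thesis
      by (simp add: interval_lebesgue_integral_def einterval_def lessThan_def)
  qed
  have "\<gamma> * (LINT x:{x. \<bar>x\<bar> > \<epsilon>}|lborel. poly g x * shifted_weight \<gamma> A B s x / x)
    + (LINT x:{x. \<bar>x\<bar> > \<epsilon>}|lborel. poly q x * shifted_weight \<gamma> A B s x)
    = (LINT x:{x. \<bar>x\<bar> > \<epsilon>}|lborel. \<gamma> * (poly g x * shifted_weight \<gamma> A B s x / x)
        + poly q x * shifted_weight \<gamma> A B s x)"
    by (simp only: set_integral_mult_right
        set_integral_add(2)[OF set_integrable_mult_right[OF truncated_integrable[OF assms(1,2)]] int_q])
  also have "\<dots> = (LINT x:{x. \<bar>x\<bar> > \<epsilon>}|lborel. (A + B * heaviside x) * f x)"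
    by (simp add: f_def shifted_weight_def algebra_simps)
  \<comment> \<open>The step factor is constant on each side of the cut: A on the left, A + B on the
    right.\<close>
  also have "\<dots> = (LINT x|lborel. A * (indicator {..<-\<epsilon>} x *\<^sub>R f x) + (A + B) * (indicator {\<epsilon><..} x *\<^sub>R f x))"
    unfolding set_lebesgue_integral_def
    by (rule Bochner_Integration.integral_cong)
      (use assms(2) in \<open>auto simp: indicator_def heaviside_def\<close>)
  also have "\<dots> = A * F (- \<epsilon>) - (A + B) * F \<epsilon>"
  proof -
    have "set_integrable lborel {..<-\<epsilon>} f" "set_integrable lborel {\<epsilon><..} f"
      by (rule set_integrable_subset[OF int_f]; auto)+
    then have "(LINT x|lborel. A * (indicator {..<-\<epsilon>} x *\<^sub>R f x) + (A + B) * (indicator {\<epsilon><..} x *\<^sub>R f x))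
        = A * (LINT x:{..<-\<epsilon>}|lborel. f x) + (A + B) * (LINT x:{\<epsilon><..}|lborel. f x)"
      unfolding set_integrable_def set_lebesgue_integral_def by simp
    then show ?thesis
      by (simp add: left right)
  qed
  finally show ?thesis
    using assms(2) by (simp add: F_def k_def algebra_simps)
qed

text \<open>The added term B g(0) \<epsilon> powr \<gamma> cancels the divergent part of the boundary terms, and what
  remains is of order \<epsilon> powr (\<gamma> + 1).\<close>

lemma truncated_cauchy_tendsto:
  fixes g :: "real poly" and s :: real
  assumes "\<gamma> > -1"
  shows "((\<lambda>\<epsilon>. \<gamma> * (LINT x:{x. \<bar>x\<bar> > \<epsilon>}|lborel. poly g x * shifted_weight \<gamma> A B s x / x)
      + B * poly g 0 * \<epsilon> powr \<gamma>) \<longlongrightarrow>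
    - moment_functional \<gamma> A B s (pderiv g - [:s, 2:] * g)) (at_right 0)"
proof -
  define q where "q = pderiv g - [:s, 2:] * g"
  define k where "k x = poly g x * exp (- (x\<^sup>2) - s * x)" for x
  define k' where "k' = poly (pderiv g) 0 - s * poly g 0"
  have "(k has_real_derivative k') (at 0)"
    unfolding k_def[abs_def] k'_def by (auto intro!: derivative_eq_intros)
  then have quot: "((\<lambda>e. (k e - k 0) / e) \<longlongrightarrow> k') (at 0)"
    by (simp add: has_field_derivative_iff)
  have quot_right: "((\<lambda>e. (k e - k 0) / e) \<longlongrightarrow> k') (at_right 0)"
    using quot by (simp add: filterlim_at_split)
  have "((\<lambda>e. (k e - k 0) / e) \<longlongrightarrow> k') (at_left 0)"
    using quot by (simp add: filterlim_at_split)
  then have quot_left: "((\<lambda>e. (k (- e) - k 0) / - e) \<longlongrightarrow> k') (at_right 0)"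
    by (subst (asm) filterlim_at_left_to_right) simp
  \<comment> \<open>The corrected boundary terms written as difference quotients of k at 0; their
    bounded limits are multiplied by a positive power of e because \<gamma> + 1 > 0.\<close>
  have "((\<lambda>e. e powr (\<gamma> + 1) * (- A * ((k (- e) - k 0) / - e) - (A + B) * ((k e - k 0) / e)))
      \<longlongrightarrow> 0 * (- A * k' - (A + B) * k')) (at_right 0)"
  proof (intro tendsto_intros quot_left quot_right)
    show "((\<lambda>e::real. e powr (\<gamma> + 1)) \<longlongrightarrow> 0) (at_right 0)"
      using assms by real_asymp
  qed
  then have boundary: "((\<lambda>e. e powr (\<gamma> + 1) * (- A * ((k (- e) - k 0) / - e) - (A + B) * ((k e - k 0) / e)))
      \<longlongrightarrow> 0) (at_right 0)"
    by simp
  have "((\<lambda>e. LINT x:{x. \<bar>x\<bar> > e}|lborel. poly q x * shifted_weight \<gamma> A B s x) \<longlongrightarrow>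
      moment_functional \<gamma> A B s q) (at_right 0)"
    unfolding moment_functional_def
    by (rule truncated_integral_tendsto[OF integrable_poly_shifted_weight[OF assms]])
      (simp add: shifted_weight_def)
  from tendsto_diff[OF boundary this]
  have lim: "((\<lambda>e. e powr (\<gamma> + 1) * (- A * ((k (- e) - k 0) / - e) - (A + B) * ((k e - k 0) / e))
      - (LINT x:{x. \<bar>x\<bar> > e}|lborel. poly q x * shifted_weight \<gamma> A B s x)) \<longlongrightarrow>
      - moment_functional \<gamma> A B s q) (at_right 0)"
    by simp
  have "\<forall>\<^sub>F e in at_right 0. e powr (\<gamma> + 1) * (- A * ((k (- e) - k 0) / - e) - (A + B) * ((k e - k 0) / e))
      - (LINT x:{x. \<bar>x\<bar> > e}|lborel. poly q x * shifted_weight \<gamma> A B s x)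
      = \<gamma> * (LINT x:{x. \<bar>x\<bar> > e}|lborel. poly g x * shifted_weight \<gamma> A B s x / x)
        + B * poly g 0 * e powr \<gamma>"
    using eventually_at_right_less[of "0 :: real"]
  proof eventually_elim
    case (elim e)
    have "e powr (\<gamma> + 1) * (- A * ((k (- e) - k 0) / - e) - (A + B) * ((k e - k 0) / e))
        = e powr \<gamma> * (A * k (- e) - (A + B) * k e) + B * k 0 * e powr \<gamma>"
      using elim by (simp add: powr_add field_simps)
    moreover have "B * k 0 * e powr \<gamma> = B * poly g 0 * e powr \<gamma>"
      by (simp add: k_def)
    moreover have "\<gamma> * (LINT x:{x. \<bar>x\<bar> > e}|lborel. poly g x * shifted_weight \<gamma> A B s x / x)
        + (LINT x:{x. \<bar>x\<bar> > e}|lborel. poly q x * shifted_weight \<gamma> A B s x)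
        = e powr \<gamma> * (A * k (- e) - (A + B) * k e)"
      unfolding q_def k_def by (rule truncated_by_parts[OF assms elim])
    ultimately show ?case by linarith
  qed
  from Lim_transform_eventually[OF lim this] show ?thesis
    unfolding q_def .
qed

text \<open>The finite-part formula for g = x q: the factor x cancels the kernel, and g(0) = 0 makes
  the correction vanish, so the limit is also \<gamma> times the moment of q.\<close>

lemma moment_functional_pearson:
  assumes "\<gamma> > -1"
  shows "moment_functional \<gamma> A B s ([:0, 1:] * pderiv q) =
    moment_functional \<gamma> A B s ([:- (1 + \<gamma>), s, 2:] * q)"
proof -
  define L where "L = moment_functional \<gamma> A B s"
  define g where "g = [:0, 1:] * q"
  note add = moment_functional_add[OF assms, of A B s, folded L_def]
  note smult = moment_functional_smult[of \<gamma> A B s, folded L_def]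
  have "((\<lambda>\<epsilon>. \<gamma> * (LINT x:{x. \<bar>x\<bar> > \<epsilon>}|lborel. poly q x * shifted_weight \<gamma> A B s x)) \<longlongrightarrow>
      \<gamma> * L q) (at_right 0)"
    unfolding L_def moment_functional_def
    by (intro tendsto_intros truncated_integral_tendsto integrable_poly_shifted_weight assms)
      (simp add: shifted_weight_def)
  moreover have "\<forall>\<^sub>F \<epsilon> in at_right 0.
      \<gamma> * (LINT x:{x. \<bar>x\<bar> > \<epsilon>}|lborel. poly q x * shifted_weight \<gamma> A B s x) =
      \<gamma> * (LINT x:{x. \<bar>x\<bar> > \<epsilon>}|lborel. poly g x * shifted_weight \<gamma> A B s x / x) + B * poly g 0 * \<epsilon> powr \<gamma>"
    using eventually_at_right_less[of "0 :: real"]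
  proof eventually_elim
    case (elim \<epsilon>)
    have "(LINT x:{x. \<bar>x\<bar> > \<epsilon>}|lborel. poly q x * shifted_weight \<gamma> A B s x) =
        (LINT x:{x. \<bar>x\<bar> > \<epsilon>}|lborel. poly g x * shifted_weight \<gamma> A B s x / x)"
      unfolding set_lebesgue_integral_def
      by (rule Bochner_Integration.integral_cong) (use elim in \<open>auto simp: g_def indicator_def\<close>)
    moreover have "poly g 0 = 0"
      by (simp add: g_def)
    ultimately show ?case
      by simp
  qed
  ultimately have "((\<lambda>\<epsilon>. \<gamma> * (LINT x:{x. \<bar>x\<bar> > \<epsilon>}|lborel. poly g x * shifted_weight \<gamma> A B s x / x)
      + B * poly g 0 * \<epsilon> powr \<gamma>) \<longlongrightarrow> \<gamma> * L q) (at_right 0)"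
    by (rule Lim_transform_eventually)
  then have "\<gamma> * L q = - L (pderiv g - [:s, 2:] * g)"
    using truncated_cauchy_tendsto[OF assms, of g A B s] unfolding L_def
    by (intro tendsto_unique[OF trivial_limit_at_right_real])
  moreover have "pderiv g - [:s, 2:] * g =
      smult (- \<gamma>) q + ([:0, 1:] * pderiv q + smult (- 1) ([:- (1 + \<gamma>), s, 2:] * q))"
    by (rule poly_eq_poly_eq_iff[THEN iffD1])
      (auto simp: g_def fun_eq_iff pderiv_mult pderiv_pCons algebra_simps)
  ultimately have "\<gamma> * L q = \<gamma> * L q - L ([:0, 1:] * pderiv q) + L ([:- (1 + \<gamma>), s, 2:] * q)"
    by (simp only: add smult)
  then show ?thesis
    by (simp add: L_def)
qed

text \<open>Dividing by x turns |x|^\<gamma> into sgn x |x|^(\<gamma> - 1), whose exponent exceeds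
  -1.\<close>

lemma integrable_cauchy_shifted_weight:
  assumes "\<gamma> > 0"
  shows "integrable lborel (\<lambda>x. poly g x * shifted_weight \<gamma> A B s x / x)"
proof -
  obtain C K where CK: "C \<ge> 0" "\<And>x. \<bar>poly g x\<bar> \<le> C * exp (K * \<bar>x\<bar>)"
    using poly_exp_bound by blast
  have "integrable lborel (\<lambda>x. (poly g x * sgn x) * shifted_weight (\<gamma> - 1) A B s x)"
  proof (rule integrable_shifted_weight)
    show "\<bar>poly g x * sgn x\<bar> \<le> C * exp (K * \<bar>x\<bar>)" for x
      using CK(2)[of x] order_trans[OF abs_ge_zero CK(2)[of x]] by (auto simp: sgn_if)
  qed (use assms in auto)
  moreover have "(poly g x * sgn x) * shifted_weight (\<gamma> - 1) A B s x = poly g x * shifted_weight \<gamma> A B s x / x" for x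
    by (auto simp: shifted_weight_def sgn_if powr_diff)
  ultimately show ?thesis
    by simp
qed

text \<open>After the shift y = s + x both branches of the definition are the limit in
  \<open>truncated_cauchy_tendsto\<close>: for \<gamma> > 0 the truncated integrals converge to the
  full one and the correction tends to 0; otherwise the limit is the definition itself.\<close>

lemma scaled_cauchy_integral_eq:
  assumes "\<gamma> > -1"
  defines "g \<equiv> \<lambda>s p. pcompose p [:s, 1:] * pcompose p [:s, 1:]"
  shows "scaled_cauchy_integral \<gamma> A B s p =
    - moment_functional \<gamma> A B s (pderiv (g s p) - [:s, 2:] * g s p)"
proof -
  define G where "G = g s p"
  have G: "(poly p (s + x))\<^sup>2 = poly G x" for x
    by (simp add: G_def g_def poly_pcompose power2_eq_square add.commute)
  have trunc: "(LINT y:{y. \<bar>y - s\<bar> > \<epsilon>}|lborel. (poly p y)\<^sup>2 * weight \<gamma> A B s y / (y - s)) =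
      (LINT x:{x. \<bar>x\<bar> > \<epsilon>}|lborel. poly G x * shifted_weight \<gamma> A B s x / x)" for \<epsilon>
    unfolding set_lebesgue_integral_def
    by (subst lborel_integral_shift[of _ s]) (simp add: weight_shift G indicator_def)
  have full: "(LINT y|lborel. (poly p y)\<^sup>2 * weight \<gamma> A B s y / (y - s)) =
      (LINT x|lborel. poly G x * shifted_weight \<gamma> A B s x / x)"
    by (subst lborel_integral_shift[of _ s]) (simp add: weight_shift G)
  have G0: "(poly p s)\<^sup>2 = poly G 0"
    using G[of 0] by simp
  note lim = truncated_cauchy_tendsto[OF assms(1), of G A B s]
  show ?thesis
  proof (cases "\<gamma> > 0")
    case True
    have "((\<lambda>\<epsilon>. \<epsilon> powr \<gamma>) \<longlongrightarrow> 0) (at_right 0)"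
      using True by real_asymp
    then have "((\<lambda>\<epsilon>. \<gamma> * (LINT x:{x. \<bar>x\<bar> > \<epsilon>}|lborel. poly G x * shifted_weight \<gamma> A B s x / x)
        + B * poly G 0 * \<epsilon> powr \<gamma>) \<longlongrightarrow>
      \<gamma> * (LINT x|lborel. poly G x * shifted_weight \<gamma> A B s x / x) + B * poly G 0 * 0) (at_right 0)"
      by (intro tendsto_intros truncated_integral_tendsto integrable_cauchy_shifted_weight True) auto
    from tendsto_unique[OF trivial_limit_at_right_real this lim] show ?thesis
      using True by (simp add: scaled_cauchy_integral_def full G_def)
  next
    case False
    then have "scaled_cauchy_integral \<gamma> A B s p = Lim (at_right 0) (\<lambda>\<epsilon>.
        \<gamma> * (LINT x:{x. \<bar>x\<bar> > \<epsilon>}|lborel. poly G x * shifted_weight \<gamma> A B s x / x)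
        + B * poly G 0 * \<epsilon> powr \<gamma>)"
      unfolding scaled_cauchy_integral_def trunc G0 by simp
    also have "\<dots> = - moment_functional \<gamma> A B s (pderiv G - [:s, 2:] * G)"
      by (rule tendsto_Lim[OF trivial_limit_at_right_real lim])
    finally show ?thesis
      by (simp only: G_def)
  qed
qed

section \<open>The Painleve equation\<close>

lemma twice_differentiable_atI:
  assumes "\<And>s. (f has_real_derivative f1 s) (at s)" "\<And>s. (f1 has_real_derivative f2 s) (at s)"
  shows "twice_differentiable_at f s" "deriv f = f1" "deriv (deriv f) = f2"
proof -
  show 1: "deriv f = f1"
    using assms(1) by (auto intro: DERIV_imp_deriv)
  show "deriv (deriv f) = f2"
    unfolding 1 using assms(2) by (auto intro: DERIV_imp_deriv)
  show "twice_differentiable_at f s"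
    unfolding twice_differentiable_at_def 1
    using assms by (auto intro!: always_eventually simp: real_differentiable_def)
qed

text \<open>The rescaling R(-2 s) at s = - t / 2 solves Painleve IV in its standard normalisation.
  The last conjunct is the equation for R / 2, with u standing for - t / 4 and derivatives taken in
  t.\<close>

theorem theorem6p1:
  fixes A B \<gamma> t u \<theta>1 \<theta>2 :: real
    and n :: nat
    and P :: "real \<Rightarrow> nat \<Rightarrow> real poly"
    and h :: "real \<Rightarrow> nat \<Rightarrow> real"
    and R Rt :: "real \<Rightarrow> real"
  assumes "A \<ge> 0" and "A + B \<ge> 0" and "\<gamma> > -1"
    and "\<And>s. monic_orthogonal (weight \<gamma> A B s) (P s) (h s)"
    and "\<And>s. R s = 1 / h s n * scaled_cauchy_integral \<gamma> A B s (P s n)"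
    and "R t \<noteq> 0"
    and "\<And>s. Rt s = 1 / 2 * R s"
    and "u = - (1 / 4) * t"
    and "\<theta>1 = (2 * real n + 1 + \<gamma>) / 4" and "\<theta>2 = - (\<gamma>\<^sup>2) / 8"
  shows
    "twice_differentiable_at R t \<and>
     deriv (deriv R) t =
       (deriv R t)\<^sup>2 / (2 * R t) + 3 / 8 * (R t) ^ 3 - t / 2 * (R t)\<^sup>2
       + 1 / 8 * (t\<^sup>2 - 8 * real n - 4 - 4 * \<gamma>) * R t - \<gamma>\<^sup>2 / (2 * R t) \<and>
     painleve_IV (2 * real n + 1 + \<gamma>) (- 2 * \<gamma>\<^sup>2) (\<lambda>s. R (- 2 * s)) (- t / 2) \<and>
     deriv (deriv Rt) t =
       (deriv Rt t)\<^sup>2 / (2 * Rt t) + 3 / 2 * (Rt t) ^ 3 + 4 * u * (Rt t)\<^sup>2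
       + 2 * (u\<^sup>2 - \<theta>1) * Rt t + \<theta>2 / Rt t"
proof -
  define L where "L = moment_functional \<gamma> A B"
  define Q where "Q s n = pcompose (P s n) [:s, 1:]" for s n
  have orth: "(LINT z|lborel. poly (P s j) z * poly (P s i) z * weight \<gamma> A B s z) = (if i = j then h s j else 0)"
    and deg_P: "degree (P s i) = i" and monic_P: "lead_coeff (P s i) = 1" for s i j
    using assms(4)[of s] unfolding monic_orthogonal_def by blast+
  \<comment> \<open>If A = B = 0 the weight and hence \<open>h t n\<close> are 0. Division by zero
    then gives R t = 0, against the assumption.\<close>
  have nondegenerate: "A \<noteq> 0 \<or> B \<noteq> 0"
  proof (rule ccontr)
    assume "\<not> (A \<noteq> 0 \<or> B \<noteq> 0)"
    then have "h t n = 0"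
      using orth[of t n n] by (simp add: weight_def)
    then show False
      using assms(5)[of t] assms(6) by simp
  qed
  have deg_Q: "degree (Q s i) = i" for s i
    by (simp add: Q_def degree_pcompose deg_P)
  have monic_Q: "coeff (Q s i) i = 1" for s i
    using lead_coeff_comp[of "[:s, 1:]" "P s i"] monic_P[of s i]
    by (simp add: Q_def degree_pcompose deg_P)
  have L_Q: "L s (Q s i * Q s j) = (if i = j then h s j else 0)" for s i j
    unfolding orth[of s j i, symmetric] L_def moment_functional_def
    by (subst (2) lborel_integral_shift[of _ s])
      (simp add: weight_shift[of \<gamma> A B s, unfolded add.commute[of s]] Q_def poly_pcompose add.commute[of s] mult_ac)
  have h_nonzero: "h s i \<noteq> 0" for s i
  proof -
    have "Q s i \<noteq> 0"
      using monic_Q[of s i] by auto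
    then show ?thesis
      using moment_functional_square_nonzero[OF assms(3,1,2) nondegenerate, of "Q s i" s] L_Q[of s i i]
      by (simp add: L_def)
  qed
  interpret pearson_functional L \<gamma> Q h
    using assms(3) deg_Q monic_Q L_Q h_nonzero
    by unfold_locales (simp_all only: L_def moment_functional_add moment_functional_smult
        moment_functional_has_derivative moment_functional_pearson not_False_eq_True)
  \<comment> \<open>The integration by parts and \<open>L_ladder\<close> evaluate the same
    expression, and division by \<open>h s n\<close> yields R.\<close>
  have R: "R = (\<lambda>s. 2 * \<alpha> s n + s)"
  proof
    fix s
    have "scaled_cauchy_integral \<gamma> A B s (P s n) = (2 * \<alpha> s n + s) * h s n"
      using scaled_cauchy_integral_eq[OF assms(3), of A B s "P s n"] L_ladder[of s n]
      unfolding L_def Q_def by simp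
    then show "R s = 2 * \<alpha> s n + s"
      using h_nonzero by (simp add: assms(5))
  qed
  obtain R1 R2 where R1: "\<And>s. (R has_real_derivative R1 s) (at s)"
    and R2: "\<And>s. (R1 has_real_derivative R2 s) (at s)"
    and ode: "\<And>s. R s \<noteq> 0 \<Longrightarrow> R2 s = (R1 s)\<^sup>2 / (2 * R s) + 3 / 8 * (R s) ^ 3 - s / 2 * (R s)\<^sup>2
       + 1 / 8 * (s\<^sup>2 - 8 * real n - 4 - 4 * \<gamma>) * R s - \<gamma>\<^sup>2 / (2 * R s)"
    using painleve_ode[of n] unfolding R by blast
  note R_deriv = twice_differentiable_atI[OF R1 R2]
  have scaled: "((\<lambda>s. f (- 2 * s)) has_real_derivative - 2 * f' (- 2 * s)) (at s)"
    if "\<And>s. (f has_real_derivative f' s) (at s)" for f f' :: "real \<Rightarrow> real" and s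
  proof -
    have "((\<lambda>s. - 2 * s) has_real_derivative - 2) (at s)"
      by (auto intro!: derivative_eq_intros)
    from DERIV_chain2[OF that this] show ?thesis
      by (simp only: mult.commute)
  qed
  have S1: "((\<lambda>s. R (- 2 * s)) has_real_derivative - 2 * R1 (- 2 * s)) (at s)" for s
    by (rule scaled[OF R1])
  have S2: "((\<lambda>s. - 2 * R1 (- 2 * s)) has_real_derivative 4 * R2 (- 2 * s)) (at s)" for s
    by (rule DERIV_cong[OF DERIV_cmult[OF scaled[OF R2]]]) simp
  note S_deriv = twice_differentiable_atI[OF S1 S2]
  have Rt: "Rt = (\<lambda>s. 1 / 2 * R s)"
    using assms(7) by auto
  have T1: "((\<lambda>s. 1 / 2 * R s) has_real_derivative 1 / 2 * R1 s) (at s)" for s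
    by (rule DERIV_cmult[OF R1])
  have T2: "((\<lambda>s. 1 / 2 * R1 s) has_real_derivative 1 / 2 * R2 s) (at s)" for s
    by (rule DERIV_cmult[OF R2])
  note T_deriv = twice_differentiable_atI[OF T1 T2]
  note ode_t = ode[OF assms(6)]
  have "painleve_IV (2 * real n + 1 + \<gamma>) (- 2 * \<gamma>\<^sup>2) (\<lambda>s. R (- 2 * s)) (- t / 2)"
    unfolding painleve_IV_def S_deriv(3) unfolding S_deriv(2)
    using S_deriv(1) assms(6) by (simp add: ode_t) (simp add: field_simps power2_eq_square power3_eq_cube)
  moreover have "deriv (deriv Rt) t =
       (deriv Rt t)\<^sup>2 / (2 * Rt t) + 3 / 2 * (Rt t) ^ 3 + 4 * u * (Rt t)\<^sup>2
       + 2 * (u\<^sup>2 - \<theta>1) * Rt t + \<theta>2 / Rt t"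
    unfolding Rt T_deriv(3) unfolding T_deriv(2) ode_t assms(8-10)
    using assms(6) by (simp add: field_simps power2_eq_square power3_eq_cube)
  ultimately show ?thesis
    using R_deriv ode_t by simp
qed

end
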